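(* Consider APE$^2$ with parameter $c>0$ and a perturbation CDF $F$ satisfying the perturbation assumption, on any $K$-armed bandit problem with $\mathbb{E}|\mathbf{R}_{t,a}|^p\le\nu_p<\infty$. Then $$\mathbb{E}[\mathcal{R}_T]=O\!\left(\sum_{a\ne a^\star}\left[\frac{C_{c,p,\nu_p,F}}{\Delta_a^{\frac{1}{p-1}}}+\frac{(6c)^{\frac{p}{p-1}}}{\Delta_a^{\frac{1}{p-1}}}\left[-F^{-1}\!\left(\frac{c^{\frac{p}{p-1}}}{T\Delta_a^{\frac{p}{p-1}}}\right)\right]_+^{\frac{p}{p-1}}+\frac{(3c)^{\frac{p}{p-1}}}{\Delta_a^{\frac{1}{p-1}}}\left[F^{-1}\!\left(1-\frac{c^{\frac{p}{p-1}}}{T\Delta_a^{\frac{p}{p-1}}}\right)\right]_+^{\frac{p}{p-1}}+\Delta_a\right]\right),$$ where $[x]_+=\max(x,0)$, $C_{c,p,\nu_p,F}>0$ is a constant depending only on $c,p,\nu_p$ and $F$ (not on $T$ or the $\Delta_a$), the hidden constant is absolute, and a term containing $F^{-1}$ is taken to be $0$ when its argument is not in $(0,1)$.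
   Context: Bandit setting: $K$ actions $\mathcal{A}$; at round $t$ the agent picks $a_t$ and observes $\mathbf{R}_{t,a_t}=r_{a_t}+\epsilon_{t,a_t}$, where $r_a\in[0,1]$, the noises $\epsilon_{t,a}$ are independent, i.i.d. over $t$, mean $0$; $p\in(1,2]$ and $\mathbb{E}|\mathbf{R}_{t,a}|^p\le\nu_p$. There is a unique optimal arm $a^\star=\arg\max_a r_a$, $\Delta_a=r_{a^\star}-r_a$, and $\mathcal{R}_T=\sum_{t=1}^T(r_{a^\star}-r_{a_t})$. $n_{t,a}$ = number of pulls of $a$ in rounds $1..t$. $b_p:=\left[2\left(\frac{2-p}{p-1}\right)^{1-\frac{2}{p}}+\left(\frac{2-p}{p-1}\right)^{2-\frac{2}{p}}\right]^{-p/2}$ (with $0^0=1$), $\psi_p(x):=\ln(b_p|x|^p+x+1)$ for $x\ge0$, $\psi_p(x):=-\ln(b_p|x|^p-x+1)$ for $x<0$. APE$^2$ with parameter $c>0$ and perturbation CDF $F$: in rounds $1,\dots,K$ each arm is pulled once. For $t>K$ and each $a$, with $n=n_{t-1,a}$, set $\hat r_{t-1,a}:=\frac{c}{n^{1-1/p}}\sum_{k\le t-1:\,a_k=a}\psi_p\!\left(\frac{\mathbf{R}_{k,a}}{c\,n^{1/p}}\right)$ and $\beta_{t-1,a}:=c/n^{1-1/p}$; draw $G_{t,a}\sim F$ independently of everything else, and choose $a_t=\arg\max_a\{\hat r_{t-1,a}+\beta_{t-1,a}G_{t,a}\}$. Perturbation assumption: $F(g)=\mathbb{P}(G<g)$ is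 a continuous, differentiable CDF with unbounded support; $F$ is log-concave; $F(0)\le1/2$; and with hazard rate $h(x):=\frac{d}{dx}\ln\frac{1}{1-F(x)}$ there is $C_F<\infty$ with $\int_0^\infty\frac{h(x)e^{-x}}{1-F(x)}dx\le C_F$. $F^{-1}(y):=\inf\{x:F(x)\ge y\}$ for $y\in(0,1)$. *)

theory Defs
  imports "HOL-Probability.Probability"
begin

text \<open>Power with the convention 0^0 = 1 (Isabelle's powr has 0 powr 0 = 0).\<close>
definition pw :: "real \<Rightarrow> real \<Rightarrow> real" where
  "pw x y = (if x = 0 \<and> y = 0 then 1 else x powr y)"

definition bp :: "real \<Rightarrow> real" where
  "bp p = (let s = (2 - p) / (p - 1) in
           (2 * pw s (1 - 2 / p) + pw s (2 - 2 / p)) powr (- p / 2))"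

definition psi :: "real \<Rightarrow> real \<Rightarrow> real" where
  "psi p x = (if 0 \<le> x then ln (bp p * \<bar>x\<bar> powr p + x + 1)
              else - ln (bp p * \<bar>x\<bar> powr p - x + 1))"

text \<open>Arms are 0..K-1. A history h is the list of actions of rounds 1..length h
  (h ! k is the action of round k+1). Rw (k,a) is the reward R_{k,a} of arm a at round k,
  Gw (t,a) is the perturbation G_{t,a}.\<close>

definition npulls :: "nat list \<Rightarrow> nat \<Rightarrow> nat" where
  "npulls h a = length (filter (\<lambda>b. b = a) h)"

definition ape_est :: "real \<Rightarrow> real \<Rightarrow> (nat \<times> nat \<Rightarrow> real) \<Rightarrow> nat list \<Rightarrow> nat \<Rightarrow> real" where
  "ape_est p c Rw h a =
     (let n = real (npulls h a) in
      c / n powr (1 - 1 / p) *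
        (\<Sum>k<length h. if h ! k = a then psi p (Rw (Suc k, a) / (c * n powr (1 / p))) else 0))"

definition ape_beta :: "real \<Rightarrow> real \<Rightarrow> nat list \<Rightarrow> nat \<Rightarrow> real" where
  "ape_beta p c h a = c / real (npulls h a) powr (1 - 1 / p)"

definition ape_index ::
  "real \<Rightarrow> real \<Rightarrow> (nat \<times> nat \<Rightarrow> real) \<Rightarrow> (nat \<times> nat \<Rightarrow> real) \<Rightarrow> nat \<Rightarrow> nat list \<Rightarrow> nat \<Rightarrow> real" where
  "ape_index p c Rw Gw t h a = ape_est p c Rw h a + ape_beta p c h a * Gw (t, a)"

definition ape_choose ::
  "nat \<Rightarrow> real \<Rightarrow> real \<Rightarrow> (nat \<times> nat \<Rightarrow> real) \<Rightarrow> (nat \<times> nat \<Rightarrow> real) \<Rightarrow> nat \<Rightarrow> nat list \<Rightarrow> nat" where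
  "ape_choose K p c Rw Gw t h =
     (if t \<le> K then t - 1
      else (LEAST a. a < K \<and> (\<forall>b<K. ape_index p c Rw Gw t h b \<le> ape_index p c Rw Gw t h a)))"

fun ape_hist ::
  "nat \<Rightarrow> real \<Rightarrow> real \<Rightarrow> (nat \<times> nat \<Rightarrow> real) \<Rightarrow> (nat \<times> nat \<Rightarrow> real) \<Rightarrow> nat \<Rightarrow> nat list" where
  "ape_hist K p c Rw Gw 0 = []"
| "ape_hist K p c Rw Gw (Suc t) =
     (let h = ape_hist K p c Rw Gw t in h @ [ape_choose K p c Rw Gw (Suc t) h])"

definition ape_regret ::
  "nat \<Rightarrow> real \<Rightarrow> real \<Rightarrow> (nat \<Rightarrow> real) \<Rightarrow> nat \<Rightarrow> nat \<Rightarrow> (nat \<times> nat \<Rightarrow> real) \<Rightarrow> (nat \<times> nat \<Rightarrow> real) \<Rightarrow> real" where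
  "ape_regret K p c r astar T Rw Gw =
     (let h = ape_hist K p c Rw Gw T in \<Sum>t<T. r astar - r (h ! t))"

text \<open>D a is the distribution of R_{t,a} (same for all t); the reward table and
  the perturbation table are independent families with these marginals.\<close>
definition mean_reward :: "(nat \<Rightarrow> real measure) \<Rightarrow> nat \<Rightarrow> real" where
  "mean_reward D a = (\<integral>x. x \<partial>(D a))"

definition bandit_space :: "(nat \<Rightarrow> real measure) \<Rightarrow> real measure
     \<Rightarrow> ((nat \<times> nat \<Rightarrow> real) \<times> (nat \<times> nat \<Rightarrow> real)) measure" where
  "bandit_space D PG = (PiM UNIV (\<lambda>ta. D (snd ta))) \<Otimes>\<^sub>M (PiM UNIV (\<lambda>_. PG))"

definition hazard :: "(real \<Rightarrow> real) \<Rightarrow> real \<Rightarrow> real" where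
  "hazard F x = deriv (\<lambda>y. ln (1 / (1 - F y))) x"

definition log_concave :: "(real \<Rightarrow> real) \<Rightarrow> bool" where
  "log_concave F \<longleftrightarrow> (\<forall>x y l. 0 < l \<and> l < 1 \<longrightarrow>
       F x powr l * F y powr (1 - l) \<le> F (l * x + (1 - l) * y))"

definition perturbation_assm :: "(real \<Rightarrow> real) \<Rightarrow> real \<Rightarrow> bool" where
  "perturbation_assm F CF \<longleftrightarrow>
     continuous_on UNIV F \<and> (\<forall>x. F differentiable (at x)) \<and>
     (\<forall>x. F x < 1) \<and> log_concave F \<and> F 0 \<le> 1 / 2 \<and>
     (\<integral>\<^sup>+ x\<in>{0..}. ennreal (hazard F x * exp (- x) / (1 - F x)) \<partial>lborel) \<le> ennreal CF"

definition Finv :: "(real \<Rightarrow> real) \<Rightarrow> real \<Rightarrow> real" where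
  "Finv F y = Inf {x. y \<le> F x}"

definition pospart :: "real \<Rightarrow> real" where
  "pospart x = max x 0"

definition bound_term :: "real \<Rightarrow> real \<Rightarrow> (real \<Rightarrow> real) \<Rightarrow> nat \<Rightarrow> real \<Rightarrow> real \<Rightarrow> real" where
  "bound_term c p F T Ccst \<Delta> =
     (let q = p / (p - 1); y = c powr q / (real T * \<Delta> powr q) in
        Ccst / \<Delta> powr (1 / (p - 1))
      + (6 * c) powr q / \<Delta> powr (1 / (p - 1))
          * (if 0 < y \<and> y < 1 then pospart (- Finv F y) powr q else 0)
      + (3 * c) powr q / \<Delta> powr (1 / (p - 1))
          * (if 0 < 1 - y \<and> 1 - y < 1 then pospart (Finv F (1 - y)) powr q else 0)
      + \<Delta>)"

end

theory Submission
  imports Defs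
begin

text \<open>Fix a suboptimal arm \<open>a\<close> with gap \<open>\<Delta>\<close>. Every pull of \<open>a\<close> after round \<open>K\<close> has
  (A) an estimate exceeding \<open>r a + \<Delta> / 3\<close>, or (B) an exploration bonus exceeding \<open>\<Delta> / 3\<close>, or
  (C) an index at most \<open>r astar - \<Delta> / 3\<close>.
  For fixed \<open>n\<close>, the exponential of \<open>\<plusminus>\<close> the psi-sum over the first \<open>n\<close> pulls of an arm, suitably
  normalised, is a supermartingale along the history, because the next reward is independent of the
  past; this gives exponential tails for the estimates although they are sampled adaptively, and
  hence bounds (A). In case (B) a perturbation exceeds its \<open>1 - y\<close> quantile as soon as \<open>n\<close> is
  large. In case (C), integrating out only the perturbation of the optimal arm bounds the event by
  the odds \<open>F z / (1 - F z)\<close> times the probability of playing the optimal arm, so one can sum over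
  the pulls of that arm; the tail bound and the layer-cake formula for \<open>1 / (1 - F)\<close>, whose
  derivative is \<open>hazard F / (1 - F)\<close>, then bring in the hazard integral.\<close>

section \<open>The influence function and stretched exponential sums\<close>

text \<open>The scale \<open>c * n powr (1 / p)\<close> inside the influence function changes with
  every pull, so all earlier rewards are re-evaluated and the successive estimates of an arm do not
  form one martingale. A separate exponential process is therefore used for each n, and a bad pull
  is charged to the number n of earlier pulls of its arm. Each n is charged at most once, so tail
  bounds summed over n = 1, ..., T suffice. In (C) the charge goes to pulls of the optimal arm. Half
  of the margin Delta / 3 pays for the deviation of the estimate, the other half for a perturbation
  below - Delta n^(1/q) / (6 c), where q = p / (p - 1). This is the origin of 6 c, while 3 c comes
  from (B). The level y = c^q / (T Delta^q) is chosen so that T rounds, each with an exceptional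
  event of probability y, cost T y Delta = c^q / Delta^(1/(p-1)), which the constant absorbs.
  Independence enters only as invariance of the product measure under redrawing one coordinate, so
  neither filtrations nor conditional expectations appear.\<close>

lemma
  assumes p: "1 < p" "p \<le> 2"
  shows bp_pos: "0 < bp p"
    and bp_powr_le: "0 < z \<Longrightarrow> bp p powr (- 2 / p) \<le> 2 * z powr (1 - 2 / p) + z powr (2 - 2 / p)"
proof -
  \<comment> \<open>\<open>bp p powr (- 2 / p)\<close> is the minimum over z > 0 of
    \<open>2 * z powr (1 - 2 / p) + z powr (2 - 2 / p)\<close>, attained at z = s; for p = 2 it is
    the infimum, approached as z tends to 0.\<close>
  define s where "s = (2 - p) / (p - 1)"
  define B where "B = 2 * pw s (1 - 2 / p) + pw s (2 - 2 / p)"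
  have bp: "bp p = B powr (- p / 2)" by (simp add: bp_def B_def s_def Let_def)
  have *: "0 < B \<and> (0 < z \<longrightarrow> B \<le> 2 * z powr (1 - 2 / p) + z powr (2 - 2 / p))" for z
  proof (cases "p = 2")
    case True
    then show ?thesis by (simp add: B_def s_def pw_def)
  next
    case False
    with p have s: "0 < s" by (simp add: s_def)
    define \<alpha> \<beta> where "\<alpha> = 2 / p - 1" and "\<beta> = 2 - 2 / p"
    have ab: "0 < \<alpha>" "0 < \<beta>" using p False by (auto simp: \<alpha>_def \<beta>_def field_simps)
    have s_eq: "s = 2 * \<alpha> / \<beta>"
      using p unfolding s_def \<alpha>_def \<beta>_def by (simp add: field_simps)
    have B: "B = 2 * s powr (- \<alpha>) + s powr \<beta>"
      using s by (simp add: B_def pw_def \<alpha>_def \<beta>_def)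
    have sb: "s powr \<beta> = s powr (- \<alpha>) * s"
      using s powr_add[of s "- \<alpha>" 1] by (simp add: \<alpha>_def \<beta>_def)
    have "B \<le> 2 * z powr (- \<alpha>) + z powr \<beta>" if z: "0 < z"
    proof -
      define t where "t = ln (z / s)"
      have zt: "z = s * exp t" using z s by (simp add: t_def)
      \<comment> \<open>In the variable t = ln (z / s) both summands are exponentials and lie above
        their tangents at t = 0; the slopes cancel because s \<beta> = 2 \<alpha>.\<close>
      have "1 + s / 2 \<le> exp (- \<alpha> * t) + s / 2 * exp (\<beta> * t)"
      proof -
        have "1 - \<alpha> * t \<le> exp (- \<alpha> * t)" using exp_ge_add_one_self[of "- \<alpha> * t"] by simp
        moreover have "s / 2 * (1 + \<beta> * t) \<le> s / 2 * exp (\<beta> * t)"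
          using exp_ge_add_one_self[of "\<beta> * t"] s by (intro mult_left_mono) auto
        moreover have "s / 2 * (1 + \<beta> * t) = s / 2 + \<alpha> * t"
          using ab by (simp add: s_eq field_simps)
        ultimately show ?thesis by linarith
      qed
      then have "s powr (- \<alpha>) * (1 + s / 2) \<le> s powr (- \<alpha>) * (exp (- \<alpha> * t) + s / 2 * exp (\<beta> * t))"
        by (intro mult_left_mono) auto
      then show ?thesis
        unfolding B sb using s
        by (simp add: zt powr_mult sb exp_powr_real algebra_simps)
    qed
    moreover have "0 < B" using s by (simp add: B add_pos_pos)
    ultimately show ?thesis by (simp add: \<alpha>_def \<beta>_def)
  qed
  show "0 < bp p" using *[of 1] by (simp add: bp)
  show "bp p powr (- 2 / p) \<le> 2 * z powr (1 - 2 / p) + z powr (2 - 2 / p)" if "0 < z"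
    using *[of z] that p by (simp add: bp powr_powr)
qed

text \<open>With z = \<open>bp p * \<bar>u\<bar> powr p\<close>, the square of u is
  \<open>bp p powr (- 2 / p) * z powr (2 / p)\<close>, so dividing by \<open>z powr (2 / p)\<close>
  reduces the claim to \<open>bp_powr_le\<close>. This is the property for which the constant
  \<open>bp\<close> is made.\<close>

lemma square_le_bp:
  assumes p: "1 < p" "p \<le> 2"
  shows "u\<^sup>2 \<le> 2 * (bp p * \<bar>u\<bar> powr p) + (bp p * \<bar>u\<bar> powr p)\<^sup>2"
proof (cases "u = 0")
  case False
  define z where "z = bp p * \<bar>u\<bar> powr p"
  note b = bp_pos[OF p]
  have z: "0 < z" using b False by (simp add: z_def)
  have zp: "z powr (- 2 / p) = bp p powr (- 2 / p) / u\<^sup>2"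
    using b False p powr_numeral[of "\<bar>u\<bar>" "num.Bit0 num.One"]
    by (simp add: z_def powr_mult powr_powr powr_minus divide_simps)
  have "bp p powr (- 2 / p) \<le> 2 * z powr (1 - 2 / p) + z powr (2 - 2 / p)"
    by (rule bp_powr_le[OF p z])
  also have "\<dots> = (2 * z + z\<^sup>2) * z powr (- 2 / p)"
    using z powr_add[of z 1 "- 2 / p"] powr_add[of z 2 "- 2 / p"]
    by (simp add: algebra_simps powr_numeral)
  also have "\<dots> = (2 * z + z\<^sup>2) / u\<^sup>2 * bp p powr (- 2 / p)"
    by (simp only: zp times_divide_eq_left times_divide_eq_right)
  finally have "1 \<le> (2 * z + z\<^sup>2) / u\<^sup>2"
    using b by (intro mult_right_le_imp_le[of 1 "bp p powr (- 2 / p)"]) simp_all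
  then show ?thesis using False by (simp add: z_def divide_simps split: if_splits)
qed simp

lemma psi_uminus: "psi p (- x) = - psi p x"
  by (auto simp: psi_def)

text \<open>Equality for x >= 0. For x < 0 the left side is 1 / (1 - x + z) with z the power term,
  and (1 + x + z) (1 - x + z) >= 1 is \<open>square_le_bp\<close>. As \<open>psi\<close> is odd, the
  bound serves both tails.\<close>

lemma exp_psi_le:
  assumes p: "1 < p" "p \<le> 2"
  shows "exp (psi p x) \<le> 1 + x + bp p * \<bar>x\<bar> powr p"
proof (cases "0 \<le> x")
  case True
  then have "0 < bp p * \<bar>x\<bar> powr p + x + 1"
    using bp_pos[OF p] by (intro add_nonneg_pos add_nonneg_nonneg) auto
  then show ?thesis using True by (simp add: psi_def)
next
  case False
  define z where "z = bp p * \<bar>x\<bar> powr p"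
  have z: "0 < z" using bp_pos[OF p] False by (simp add: z_def)
  have "x\<^sup>2 \<le> 2 * z + z\<^sup>2" using square_le_bp[OF p, of x] by (simp add: z_def)
  then have "1 \<le> (1 + x + z) * (1 - x + z)" by (simp add: algebra_simps power2_eq_square)
  moreover have "0 < 1 - x + z" using False z by linarith
  ultimately have "1 / (1 - x + z) \<le> 1 + x + z" by (simp add: divide_simps)
  moreover have "psi p x = - ln (1 - x + z)"
    using False by (simp add: psi_def z_def algebra_simps)
  then have "exp (psi p x) = 1 / (1 - x + z)"
    using \<open>0 < 1 - x + z\<close> by (simp add: exp_minus inverse_eq_divide)
  ultimately show ?thesis by (simp add: z_def)
qed

lemma measurable_psi [measurable]: "psi p \<in> borel_measurable borel"
  unfolding psi_def by measurable

section \<open>Sums of stretched exponentials\<close>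

lemma one_plus_powr_sq_le_exp:
  fixes q :: real
  assumes "0 \<le> q"
  obtains C where "0 < C" "\<And>u. 0 \<le> u \<Longrightarrow> (1 + u powr q)\<^sup>2 \<le> C * exp u"
proof -
  define m where "m = nat \<lceil>\<bar>q\<bar>\<rceil>"
  define A where "A = (2 + 2 ^ m * fact m :: real)"
  have q: "q \<le> real m" unfolding m_def by linarith
  have A: "0 < A" by (simp add: A_def add_pos_pos)
  have "(1 + u powr q)\<^sup>2 \<le> max 4 (A\<^sup>2) * exp u" if u: "0 \<le> u" "0 \<le> q" for u
  proof -
    have "u powr q \<le> 1 + u ^ m"
    proof (cases "1 \<le> u")
      case True
      then have "u powr q \<le> u powr m" by (intro powr_mono q)
      then show ?thesis using True by (simp add: powr_realpow)
    next
      case False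
      then have "u powr q \<le> 1" using u by (intro powr_le1) auto
      then show ?thesis using u by (smt (verit) zero_le_power)
    qed
    \<comment> \<open>A single term of the exponential series at u / 2; the halving leaves exactly
      exp u after squaring.\<close>
    moreover have "(u / 2) ^ m / fact m \<le> exp (u / 2)"
    proof -
      have "(\<Sum>k\<in>{m}. (u / 2) ^ k / fact k) \<le> (\<Sum>k. (u / 2) ^ k / fact k)"
        using summable_exp[of "u / 2"] u
        by (intro sum_le_suminf) (auto simp: field_simps)
      then show ?thesis by (simp add: exp_def field_simps)
    qed
    then have "u ^ m \<le> 2 ^ m * fact m * exp (u / 2)" by (simp add: field_simps)
    moreover have "1 \<le> exp (u / 2)" using u by simp
    ultimately have "1 + u powr q \<le> 2 * exp (u / 2) + 2 ^ m * fact m * exp (u / 2)"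
      by linarith
    then have "1 + u powr q \<le> A * exp (u / 2)" by (simp add: A_def distrib_right)
    then have "(1 + u powr q)\<^sup>2 \<le> (A * exp (u / 2))\<^sup>2"
      by (intro power_mono) (auto intro: add_nonneg_nonneg)
    also have "\<dots> = A\<^sup>2 * exp u" by (simp add: power_mult_distrib flip: exp_double)
    also have "\<dots> \<le> max 4 (A\<^sup>2) * exp u" by (intro mult_right_mono) auto
    finally show ?thesis .
  qed
  then show ?thesis using that[of "max 4 (A\<^sup>2)"] assms by auto
qed


text \<open>With A = \<alpha>^q the exponent u = \<alpha> n^(1/q) satisfies u^q = A n, so each term
  is at most C / (1 + A n)^2, which telescopes to C / A. The constant depends on q alone, and as the
  sum starts at n = 1 there is no additive term.\<close>

lemma sum_exp_neg_powr_le: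
  fixes q :: real
  assumes q: "0 < q"
  obtains C where "0 < C"
    "\<And>\<alpha> N. 0 < \<alpha> \<Longrightarrow> (\<Sum>n=1..N. exp (- (\<alpha> * real n powr (1 / q)))) \<le> C / \<alpha> powr q"
proof -
  obtain C where C: "0 < C" "\<And>u. 0 \<le> u \<Longrightarrow> (1 + u powr q)\<^sup>2 \<le> C * exp u"
    using one_plus_powr_sq_le_exp[of q] q by auto
  have "(\<Sum>n=1..N. exp (- (\<alpha> * real n powr (1 / q)))) \<le> C / \<alpha> powr q" if \<alpha>: "0 < \<alpha>" for \<alpha> N
  proof -
    define A where "A = \<alpha> powr q"
    have A: "0 < A" using \<alpha> by (simp add: A_def)
    have step: "exp (- (\<alpha> * real n powr (1 / q))) \<le> C / A * (1 / (1 + A * (real n - 1)) - 1 / (1 + A * real n))"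
      if n: "1 \<le> n" for n
    proof -
      have pos: "0 < 1 + A * (real n - 1)" "0 < 1 + A * real n"
        using A n by (auto intro!: add_pos_nonneg)
      have "(\<alpha> * real n powr (1 / q)) powr q = A * real n"
        using \<alpha> q by (simp add: powr_mult powr_powr A_def)
      then have "(1 + A * real n)\<^sup>2 \<le> C * exp (\<alpha> * real n powr (1 / q))"
        using C(2)[of "\<alpha> * real n powr (1 / q)"] \<alpha> by simp
      then have "exp (- (\<alpha> * real n powr (1 / q))) \<le> C / (1 + A * real n)\<^sup>2"
        using pos by (simp add: exp_minus field_simps)
      also have "\<dots> \<le> C / ((1 + A * (real n - 1)) * (1 + A * real n))"
        using pos A C(1) by (intro divide_left_mono) (auto simp: power2_eq_square intro!: mult_right_mono mult_pos_pos)
      also have "\<dots> = C / A * (1 / (1 + A * (real n - 1)) - 1 / (1 + A * real n))"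
      proof -
        have "1 / (1 + A * (real n - 1)) - 1 / (1 + A * real n) = A / ((1 + A * (real n - 1)) * (1 + A * real n))"
          using pos by (subst diff_frac_eq) (auto simp: algebra_simps)
        then show ?thesis using A by simp
      qed
      finally show ?thesis .
    qed
    have "(\<Sum>n=1..N. exp (- (\<alpha> * real n powr (1 / q)))) \<le> C / A * (1 - 1 / (1 + A * real N))"
    proof (induction N)
      case (Suc N)
      then show ?case using step[of "Suc N"] by (simp add: algebra_simps)
    qed simp
    also have "\<dots> \<le> C / A * 1" using A C(1) by (intro mult_left_mono) auto
    finally show ?thesis by (simp add: A_def)
  qed
  with C(1) show ?thesis using that by blast
qed

section \<open>The perturbation distribution\<close>

locale perturbation =
  fixes F :: "real \<Rightarrow> real" and CF :: real and PG :: "real measure"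
  assumes assm: "perturbation_assm F CF"
    and prob_PG: "prob_space PG"
    and sets_PG [measurable_cong]: "sets PG = sets borel"
    and F_eq: "measure PG {..<g} = F g"
begin

interpretation PG: prob_space PG by (rule prob_PG)

lemma F_nonneg: "0 \<le> F x" by (simp flip: F_eq)

lemma F_less_1: "F x < 1" using assm by (simp add: perturbation_assm_def)

lemma F_0: "F 0 \<le> 1 / 2" using assm by (simp add: perturbation_assm_def)

lemma continuous_F: "continuous_on UNIV F" using assm by (simp add: perturbation_assm_def)

lemma measurable_F [measurable]: "F \<in> borel_measurable borel"
  using continuous_F by (rule borel_measurable_continuous_onI)

lemma F_mono: "x \<le> y \<Longrightarrow> F x \<le> F y"
  unfolding F_eq[symmetric] by (intro PG.finite_measure_mono) (auto simp: sets_PG)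

text \<open>\<open>F\<close> gives the mass strictly below a point; its continuity rules out atoms,
  so it is also the usual cdf.\<close>

lemma measure_PG_atMost: "measure PG {..z} = F z"
proof (rule antisym)
  have "((\<lambda>e. F (z + e)) \<longlongrightarrow> F (z + 0)) (at_right 0)"
    using continuous_F by (intro continuous_on_tendsto_compose[of UNIV F] tendsto_intros) auto
  moreover have "eventually (\<lambda>e. measure PG {..z} \<le> F (z + e)) (at_right 0)"
    using eventually_at_right_less
    by eventually_elim (auto simp: F_eq[symmetric] sets_PG intro!: PG.finite_measure_mono)
  ultimately show "measure PG {..z} \<le> F z"
    using tendsto_lowerbound trivial_limit_at_right_real by fastforce
  show "F z \<le> measure PG {..z}"
    unfolding F_eq[symmetric] by (intro PG.finite_measure_mono) (auto simp: sets_PG)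
qed

lemma emeasure_PG_atMost: "emeasure PG {..z} = ennreal (F z)"
  by (simp add: PG.emeasure_eq_measure measure_PG_atMost)

lemma emeasure_PG_greaterThan: "emeasure PG {z<..} = ennreal (1 - F z)"
proof -
  have "measure PG (space PG - {..z}) = 1 - F z"
    by (subst PG.prob_compl) (auto simp: sets_PG measure_PG_atMost)
  moreover have "space PG - {..z} = {z<..}"
    using sets_eq_imp_space_eq[OF sets_PG] by auto
  ultimately show ?thesis by (simp add: PG.emeasure_eq_measure)
qed

text \<open>The infimum is attained because the superlevel set is closed, and points to its left
  have \<open>F\<close> below y, so continuity gives equality. Hence a perturbation exceeds
  \<open>Finv F (1 - y)\<close> with probability exactly y.\<close>

lemma F_Finv:
  assumes y: "0 < y" "y < 1"
  shows "F (Finv F y) = y"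
proof -
  have "real_distribution PG"
    using prob_PG sets_PG sets_eq_imp_space_eq[OF sets_PG]
    by (simp add: real_distribution_def real_distribution_axioms_def)
  then interpret real_distribution PG .
  have cdf: "cdf PG = F" by (simp add: cdf_def measure_PG_atMost fun_eq_iff)
  obtain u where u: "y < F u"
    using order_tendstoD(1)[OF cdf_lim_at_top_prob[unfolded cdf] y(2)] eventually_happens by fastforce
  obtain l where l: "F l < y"
    using order_tendstoD(2)[OF cdf_lim_at_bot[unfolded cdf] y(1)] eventually_happens by fastforce
  define X where "X = {x. y \<le> F x}"
  have X: "X \<noteq> {}" "bdd_below X"
    using u l by (auto simp: X_def intro!: less_imp_le bdd_belowI[of _ l])
       (smt (verit) F_mono)
  have "closed X" unfolding X_def using continuous_F by (intro closed_Collect_le) auto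
  then have "Inf X \<in> X" using X by (intro closed_contains_Inf)
  moreover have "F (Inf X) \<le> y"
  proof -
    have "((\<lambda>e. F (Inf X - e)) \<longlongrightarrow> F (Inf X - 0)) (at_right 0)"
      using continuous_F by (intro continuous_on_tendsto_compose[of UNIV F] tendsto_intros) auto
    moreover have "eventually (\<lambda>e. F (Inf X - e) \<le> y) (at_right 0)"
      using eventually_at_right_less
    proof eventually_elim
      case (elim e)
      then have "Inf X - e \<notin> X" using cInf_lower[OF _ X(2)] by fastforce
      then show ?case by (simp add: X_def)
    qed
    ultimately show ?thesis
      using tendsto_upperbound trivial_limit_at_right_real by fastforce
  qed
  ultimately show ?thesis by (simp add: X_def Finv_def)
qed

text \<open>The exchange rate between missing a threshold z (probability F z) and exceeding it
  (probability 1 - F z).\<close>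

definition odds :: "real \<Rightarrow> real" where "odds z = F z / (1 - F z)"

lemma measurable_odds [measurable]: "odds \<in> borel_measurable borel"
  unfolding odds_def by measurable

lemma odds_nonneg: "0 \<le> odds z"
  using F_nonneg[of z] F_less_1[of z] by (simp add: odds_def)

lemma odds_le_nonpos: "z \<le> d \<Longrightarrow> d \<le> 0 \<Longrightarrow> odds z \<le> 2 * F d"
proof -
  assume "z \<le> d" "d \<le> 0"
  then have "F z \<le> F d" "F d \<le> 1 / 2" using F_mono[of z d] F_mono[of d 0] F_0 by auto
  moreover from this have "F d * 1 \<le> F d * (2 * (1 - F z))"
    using F_nonneg[of d] by (intro mult_left_mono) auto
  ultimately have "F z \<le> F d * (2 * (1 - F z))" by linarith
  then show ?thesis using F_less_1[of z] by (simp add: odds_def divide_simps algebra_simps)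
qed

lemma hazard_deriv:
  shows "hazard F x = deriv F x / (1 - F x)"
    and "((\<lambda>y. 1 / (1 - F y)) has_real_derivative hazard F x / (1 - F x)) (at x)"
    and "0 \<le> hazard F x"
proof -
  have "F differentiable (at x)" using assm by (simp add: perturbation_assm_def)
  then have D [derivative_intros]: "(F has_real_derivative deriv F x) (at x)"
    by (simp add: DERIV_deriv_iff_real_differentiable)
  have "(\<lambda>y. ln (1 / (1 - F y))) = (\<lambda>y. - ln (1 - F y))"
    using F_less_1 by (simp add: ln_div fun_eq_iff less_imp_neq)
  then have "((\<lambda>y. ln (1 / (1 - F y))) has_real_derivative deriv F x / (1 - F x)) (at x)"
    using F_less_1[of x] by (auto intro!: derivative_eq_intros)
  then show *: "hazard F x = deriv F x / (1 - F x)" unfolding hazard_def by (rule DERIV_imp_deriv)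
  show "((\<lambda>y. 1 / (1 - F y)) has_real_derivative hazard F x / (1 - F x)) (at x)"
    unfolding * using F_less_1[of x]
    by (auto intro!: derivative_eq_intros simp: field_simps power2_eq_square)
  have "0 \<le> deriv F x"
    by (rule mono_on_imp_deriv_nonneg[OF _ D, of UNIV]) (auto intro: mono_onI F_mono)
  then show "0 \<le> hazard F x" unfolding * using F_less_1[of x] by simp
qed

text \<open>\<open>F\<close> is merely differentiable, so \<open>deriv F\<close> may be
  discontinuous; it is measurable as a pointwise limit of difference quotients with steps 1 / (n +
  1).\<close>

lemma measurable_hazard [measurable]: "hazard F \<in> borel_measurable borel"
proof -
  have "deriv F \<in> borel_measurable borel"
  proof (rule borel_measurable_LIMSEQ_real)
    fix x
    have "F differentiable (at x)" using assm by (simp add: perturbation_assm_def)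
    then have "((\<lambda>h. (F (x + h) - F x) / h) \<longlongrightarrow> deriv F x) (at 0)"
      by (simp add: DERIV_deriv_iff_real_differentiable[symmetric] DERIV_def)
    moreover have "filterlim (\<lambda>n. 1 / real (Suc n)) (at 0) sequentially"
      using LIMSEQ_inverse_real_of_nat by (auto simp: filterlim_at inverse_eq_divide)
    ultimately show "(\<lambda>n. (F (x + 1 / real (Suc n)) - F x) / (1 / real (Suc n))) \<longlonglongrightarrow> deriv F x"
      by (rule filterlim_compose)
  qed measurable
  then show ?thesis unfolding hazard_deriv(1)[abs_def] by measurable
qed

text \<open>Three ranges of z. Up to - d the odds are at most 2 F(- d); between - d and 0 they are
  at most 1, since F 0 <= 1/2; above 0 they are at most 1 / (1 - F z), which is 1 / (1 - F 0) <= 2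
  plus the integral of its derivative. The split point d remains free.\<close>

lemma ennreal_odds_le:
  assumes d: "0 \<le> d"
  shows "ennreal (odds z) \<le> ennreal (2 * F (- d)) + indicator {- d..} z
    + (2 * indicator {0..} z + (\<integral>\<^sup>+x. ennreal (hazard F x / (1 - F x)) * indicator {0..z} x \<partial>lborel))"
proof -
  consider "z \<le> - d" | "- d < z" "z \<le> 0" | "0 < z" by linarith
  then show ?thesis
  proof cases
    case 1
    then have "ennreal (odds z) \<le> ennreal (2 * F (- d))"
      using d by (intro ennreal_leI odds_le_nonpos) auto
    then show ?thesis by (meson add_increasing2 zero_le)
  next
    case 2
    then have "odds z \<le> 1" using odds_le_nonpos[of z 0] F_0 by simp
    then have "ennreal (odds z) \<le> indicator {- d..} z" using 2 by simp
    then show ?thesis by (meson add_increasing add_increasing2 zero_le)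
  next
    case 3
    have F0: "1 / (1 - F 0) \<le> 2" using F_0 by (simp add: field_simps)
    have I: "(\<integral>\<^sup>+x. ennreal (hazard F x / (1 - F x)) * indicator {0..z} x \<partial>lborel)
        = ennreal (1 / (1 - F z) - 1 / (1 - F 0))"
      using 3 hazard_deriv(3) F_less_1
      by (intro nn_integral_FTC_Icc) (auto intro!: divide_nonneg_pos has_field_derivative_at_within[OF hazard_deriv(2)])
    have nn: "0 \<le> 1 / (1 - F z) - 1 / (1 - F 0)"
      using 3 F_mono[of 0 z] F_less_1[of z] by (simp add: frac_le)
    have "odds z \<le> 1 / (1 - F z)" using F_less_1[of z] by (simp add: odds_def divide_simps)
    then have "odds z \<le> 2 + (1 / (1 - F z) - 1 / (1 - F 0))" using F0 by linarith
    then have "ennreal (odds z) \<le> 2 + ennreal (1 / (1 - F z) - 1 / (1 - F 0))"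
      using nn by (metis ennreal_leI ennreal_numeral ennreal_plus zero_le_numeral)
    then have "ennreal (odds z) \<le> 2 * indicator {0..} z + ennreal (1 / (1 - F z) - 1 / (1 - F 0))"
      using 3 by simp
    then show ?thesis unfolding I by (meson add_increasing zero_le)
  qed
qed

text \<open>Integrating \<open>ennreal_odds_le\<close>: the tail at - d gives B exp d, the tail at 0
  gives 2 B, and exchanging integrals turns the last term into B times the hazard integral. The
  maximum with 0 covers a negative \<open>CF\<close>, for which \<open>ennreal CF\<close> is
  0.\<close>

lemma nn_integral_odds_le:
  assumes M: "prob_space M" and E: "E \<in> sets M" and Z [measurable]: "Z \<in> borel_measurable M"
    and B: "0 \<le> B" and d: "0 \<le> d"
    and tail: "\<And>x. emeasure M {\<omega>\<in>E. x \<le> Z \<omega>} \<le> ennreal (B * exp (- x))"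
  shows "(\<integral>\<^sup>+\<omega>. ennreal (odds (Z \<omega>)) * indicator E \<omega> \<partial>M)
    \<le> ennreal (2 * F (- d) + B * exp d + (2 + max CF 0) * B)"
proof -
  interpret M: prob_space M by fact
  interpret P: pair_sigma_finite M lborel ..
  note E [measurable]
  define g where "g x = ennreal (hazard F x / (1 - F x))" for x
  have g [measurable]: "g \<in> borel_measurable borel" unfolding g_def by measurable
  define k where "k x \<omega> = (if x \<le> Z \<omega> then indicator E \<omega> else 0 :: ennreal)" for x \<omega>
  have k [measurable]: "(\<lambda>(x, \<omega>). k x \<omega>) \<in> borel_measurable (borel \<Otimes>\<^sub>M M)" unfolding k_def by measurable
  have k' [measurable]: "k x \<in> borel_measurable M" for x unfolding k_def by measurable
  have int_k: "(\<integral>\<^sup>+\<omega>. k x \<omega> \<partial>M) \<le> ennreal (B * exp (- x))" for x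
  proof -
    have eq: "{\<omega>\<in>E. x \<le> Z \<omega>} = E \<inter> (Z -` {x..} \<inter> space M)" using sets.sets_into_space[OF E] by auto
    have "{\<omega>\<in>E. x \<le> Z \<omega>} \<in> sets M" unfolding eq by simp
    moreover have "k x = indicator {\<omega>\<in>E. x \<le> Z \<omega>}" by (auto simp: k_def fun_eq_iff split: split_indicator)
    ultimately show ?thesis using tail by simp
  qed
  define h where "h \<omega> = (\<integral>\<^sup>+x. g x * indicator {0..} x * k x \<omega> \<partial>lborel)" for \<omega>
  have h [measurable]: "h \<in> borel_measurable M" unfolding h_def k_def by measurable
  have "(\<integral>\<^sup>+\<omega>. h \<omega> \<partial>M) = (\<integral>\<^sup>+x. (\<integral>\<^sup>+\<omega>. g x * indicator {0..} x * k x \<omega> \<partial>M) \<partial>lborel)"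
    unfolding h_def by (rule P.Fubini'[symmetric]) (simp add: k_def, measurable)
  also have "\<dots> \<le> (\<integral>\<^sup>+x. ennreal B * (ennreal (hazard F x * exp (- x) / (1 - F x)) * indicator {0..} x) \<partial>lborel)"
  proof (rule nn_integral_mono)
    fix x
    have "(\<integral>\<^sup>+\<omega>. g x * indicator {0..} x * k x \<omega> \<partial>M) = g x * indicator {0..} x * (\<integral>\<^sup>+\<omega>. k x \<omega> \<partial>M)"
      by (rule nn_integral_cmult) measurable
    also have "\<dots> \<le> g x * indicator {0..} x * ennreal (B * exp (- x))"
      by (intro mult_left_mono int_k) auto
    also have "\<dots> = ennreal B * (ennreal (hazard F x * exp (- x) / (1 - F x)) * indicator {0..} x)"
      using B hazard_deriv(3)[of x] F_less_1[of x]
      by (simp add: g_def ennreal_mult'[symmetric] mult_ac split: split_indicator)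
    finally show "(\<integral>\<^sup>+\<omega>. g x * indicator {0..} x * k x \<omega> \<partial>M) \<le> \<dots>" .
  qed
  also have "\<dots> = ennreal B * (\<integral>\<^sup>+x\<in>{0..}. ennreal (hazard F x * exp (- x) / (1 - F x)) \<partial>lborel)"
    by (rule nn_integral_cmult) measurable
  also have "\<dots> \<le> ennreal B * ennreal CF"
    using assm by (intro mult_left_mono) (auto simp: perturbation_assm_def)
  also have "\<dots> \<le> ennreal (B * max CF 0)"
    using B by (simp add: ennreal_mult' ennreal_neg max_def)
  finally have int_h: "(\<integral>\<^sup>+\<omega>. h \<omega> \<partial>M) \<le> ennreal (B * max CF 0)" .
  have "(\<integral>\<^sup>+\<omega>. ennreal (odds (Z \<omega>)) * indicator E \<omega> \<partial>M)
      \<le> (\<integral>\<^sup>+\<omega>. (ennreal (2 * F (- d)) + k (- d) \<omega>) + (2 * k 0 \<omega> + h \<omega>) \<partial>M)"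
  proof (rule nn_integral_mono)
    fix \<omega>
    have "h \<omega> = (\<integral>\<^sup>+x. g x * indicator {0..Z \<omega>} x \<partial>lborel)" if "\<omega> \<in> E"
      using that unfolding h_def k_def by (intro nn_integral_cong) (auto split: split_indicator)
    then show "ennreal (odds (Z \<omega>)) * indicator E \<omega> \<le> (ennreal (2 * F (- d)) + k (- d) \<omega>) + (2 * k 0 \<omega> + h \<omega>)"
      using ennreal_odds_le[OF d, of "Z \<omega>"] by (cases "\<omega> \<in> E") (auto simp: g_def k_def indicator_def)
  qed
  also have "\<dots> = (\<integral>\<^sup>+\<omega>. ennreal (2 * F (- d)) \<partial>M) + (\<integral>\<^sup>+\<omega>. k (- d) \<omega> \<partial>M)
      + (2 * (\<integral>\<^sup>+\<omega>. k 0 \<omega> \<partial>M) + (\<integral>\<^sup>+\<omega>. h \<omega> \<partial>M))"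
    by (simp add: nn_integral_add nn_integral_cmult)
  also have "\<dots> \<le> ennreal (2 * F (- d)) + ennreal (B * exp d) + (2 * ennreal B + ennreal (B * max CF 0))"
    using int_k[of "- d"] int_k[of 0] int_h by (intro add_mono mult_left_mono) (auto simp: M.emeasure_space_1)
  also have "2 * ennreal B = ennreal (2 * B)" using B by (simp add: ennreal_mult')
  also have "ennreal (2 * F (- d)) + ennreal (B * exp d) + (ennreal (2 * B) + ennreal (B * max CF 0))
      = ennreal (2 * F (- d) + B * exp d + (2 * B + B * max CF 0))"
    using B F_nonneg[of "- d"] by simp
  also have "2 * B + B * max CF 0 = (2 + max CF 0) * B" by (simp add: algebra_simps)
  finally show ?thesis .
qed

end

section \<open>Resampling one coordinate of a product measure\<close>

text \<open>Replacing one coordinate by an independent fresh copy preserves the product law.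
  Cylinders determine a product measure, and for them the preimage is a rectangle.\<close>

lemma (in product_prob_space) distr_PiM_fun_upd:
  assumes i: "i \<in> I"
  shows "distr (PiM I M \<Otimes>\<^sub>M M i) (PiM I M) (\<lambda>(\<omega>, x). fun_upd \<omega> i x) = PiM I M"
proof (rule PiM_eq)
  have meas: "(\<lambda>(\<omega>, x). fun_upd \<omega> i x) \<in> PiM I M \<Otimes>\<^sub>M M i \<rightarrow>\<^sub>M PiM I M"
    using measurable_add_dim[of i I M] i by (simp add: insert_absorb)
  show "sets (distr (PiM I M \<Otimes>\<^sub>M M i) (PiM I M) (\<lambda>(\<omega>, x). fun_upd \<omega> i x)) = sets (PiM I M)" by simp
  fix J X assume J: "finite J" "J \<subseteq> I" and X: "\<And>j. j \<in> J \<Longrightarrow> X j \<in> sets (M j)"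
  \<comment> \<open>The constraint on the fresh coordinate; a cylinder that ignores i imposes
    none.\<close>
  define Y where "Y = (if i \<in> J then X i else space (M i))"
  have Y: "Y \<in> sets (M i)" using X by (auto simp: Y_def)
  have emb: "prod_emb I M L (\<Pi>\<^sub>E j\<in>L. X j) = {\<omega>\<in>space (PiM I M). \<forall>j\<in>L. \<omega> j \<in> X j}"
    if "L \<subseteq> J" for L
    using that J X[THEN sets.sets_into_space] by (auto simp: prod_emb_def space_PiM PiE_iff extensional_def)
  have "emeasure (distr (PiM I M \<Otimes>\<^sub>M M i) (PiM I M) (\<lambda>(\<omega>, x). fun_upd \<omega> i x)) (prod_emb I M J (\<Pi>\<^sub>E j\<in>J. X j))
    = emeasure (PiM I M \<Otimes>\<^sub>M M i) ((\<lambda>(\<omega>, x). fun_upd \<omega> i x) -` (prod_emb I M J (\<Pi>\<^sub>E j\<in>J. X j)) \<inter> space (PiM I M \<Otimes>\<^sub>M M i))"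
    using J X by (intro emeasure_distr meas sets_PiM_I) auto
  also have "(\<lambda>(\<omega>, x). fun_upd \<omega> i x) -` (prod_emb I M J (\<Pi>\<^sub>E j\<in>J. X j)) \<inter> space (PiM I M \<Otimes>\<^sub>M M i)
    = {\<omega>\<in>space (PiM I M). \<forall>j\<in>J - {i}. \<omega> j \<in> X j} \<times> Y"
    unfolding emb[OF order_refl] using i sets.sets_into_space[OF Y] X[THEN sets.sets_into_space]
    by (fastforce simp: space_pair_measure space_PiM PiE_iff Y_def extensional_def split: if_splits)
  also have "emeasure (PiM I M \<Otimes>\<^sub>M M i) \<dots> = (\<Prod>j\<in>J - {i}. emeasure (M j) (X j)) * emeasure (M i) Y"
  proof -
    have JI: "J - {i} \<subseteq> I" "finite (J - {i})" "\<And>j. j \<in> J - {i} \<Longrightarrow> X j \<in> sets (M j)"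
      using J X by auto
    have "{\<omega>\<in>space (PiM I M). \<forall>j\<in>J - {i}. \<omega> j \<in> X j} \<in> sets (PiM I M)"
      unfolding emb[OF Diff_subset, symmetric] using JI by (intro sets_PiM_I) auto
    then show ?thesis
      using Y emeasure_PiM_Collect[OF JI] by (simp add: M.emeasure_pair_measure_Times)
  qed
  also have "\<dots> = (\<Prod>j\<in>J. emeasure (M j) (X j))"
  proof (cases "i \<in> J")
    case True
    then show ?thesis using J by (simp add: Y_def prod.remove mult.commute)
  next
    case False
    then show ?thesis by (simp add: Y_def M.emeasure_space_1)
  qed
  finally show "emeasure (distr (PiM I M \<Otimes>\<^sub>M M i) (PiM I M) (\<lambda>(\<omega>, x). fun_upd \<omega> i x)) (prod_emb I M J (\<Pi>\<^sub>E j\<in>J. X j))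
    = (\<Prod>j\<in>J. emeasure (M j) (X j))" .
qed

lemma (in product_prob_space) nn_integral_PiM_fun_upd:
  assumes i: "i \<in> I" and f [measurable]: "f \<in> borel_measurable (PiM I M)"
  shows "(\<integral>\<^sup>+\<omega>. f \<omega> \<partial>PiM I M) = (\<integral>\<^sup>+\<omega>. (\<integral>\<^sup>+x. f (fun_upd \<omega> i x) \<partial>M i) \<partial>PiM I M)"
proof -
  have meas [measurable]: "(\<lambda>(\<omega>, x). fun_upd \<omega> i x) \<in> PiM I M \<Otimes>\<^sub>M M i \<rightarrow>\<^sub>M PiM I M"
    using measurable_add_dim[of i I M] i by (simp add: insert_absorb)
  have "(\<integral>\<^sup>+\<omega>. f \<omega> \<partial>PiM I M) = (\<integral>\<^sup>+\<omega>. f \<omega> \<partial>distr (PiM I M \<Otimes>\<^sub>M M i) (PiM I M) (\<lambda>(\<omega>, x). fun_upd \<omega> i x))"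
    by (simp add: distr_PiM_fun_upd i)
  also have "\<dots> = (\<integral>\<^sup>+\<omega>x. f ((\<lambda>(\<omega>, x). fun_upd \<omega> i x) \<omega>x) \<partial>(PiM I M \<Otimes>\<^sub>M M i))"
    by (rule nn_integral_distr) measurable
  also have "\<dots> = (\<integral>\<^sup>+\<omega>. (\<integral>\<^sup>+x. f (fun_upd \<omega> i x) \<partial>M i) \<partial>PiM I M)"
    by (subst M.nn_integral_fst[symmetric]) (simp_all add: split_beta')
  finally show ?thesis .
qed

section \<open>Pull counts along a history\<close>

lemma npulls_Nil [simp]: "npulls [] a = 0"
  and npulls_snoc: "npulls (h @ [b]) a = npulls h a + (if b = a then 1 else 0)"
  by (simp_all add: npulls_def)

text \<open>The successive pulls of an arm see 0, 1, 2, ... earlier pulls, so a sum over pull times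
  of a function of the count becomes a sum over an initial segment of the naturals.\<close>

lemma sum_pulls:
  "(\<Sum>k<length h. if h ! k = a then f (npulls (take k h) a) else 0) = (\<Sum>n<npulls h a. f n)"
  for f :: "nat \<Rightarrow> 'b::comm_monoid_add"
proof (induction h rule: rev_induct)
  case (snoc b h)
  have "(\<Sum>k<length h. if (h @ [b]) ! k = a then f (npulls (take k (h @ [b])) a) else 0)
      = (\<Sum>k<length h. if h ! k = a then f (npulls (take k h) a) else 0)"
    by (intro sum.cong) (auto simp: nth_append)
  then show ?case using snoc by (simp add: npulls_snoc)
qed simp

lemma npulls_le_length: "npulls h a \<le> length h"
  by (simp add: npulls_def)

lemma npulls_take_le: "npulls (take k h) a \<le> npulls h a"
proof -
  have "npulls h a = npulls (take k h) a + npulls (drop k h) a"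
    unfolding npulls_def by (metis append_take_drop_id filter_append length_append)
  then show ?thesis by simp
qed

lemma npulls_eq_sum: "npulls h a = (\<Sum>k<length h. if h ! k = a then 1 else 0)"
  using sum_pulls[of h a "\<lambda>_. 1::nat"] by simp

section \<open>The bandit process\<close>

locale bandit = perturbation F CF PG
  for F :: "real \<Rightarrow> real" and CF :: real and PG :: "real measure" +
  fixes p c \<nu> :: real and K :: nat and D :: "nat \<Rightarrow> real measure" and astar :: nat
  assumes c: "0 < c" and p: "1 < p" "p \<le> 2"
    and prob_D: "\<And>a. prob_space (D a)"
    and sets_D [measurable_cong]: "\<And>a. sets (D a) = sets borel"
    and moment: "\<And>a. a < K \<Longrightarrow> (\<integral>\<^sup>+x. ennreal (\<bar>x\<bar> powr p) \<partial>D a) \<le> ennreal \<nu>"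
    and astar: "astar < K"
    and opt: "\<And>a. a < K \<Longrightarrow> a \<noteq> astar \<Longrightarrow> mean_reward D a < mean_reward D astar"
begin

abbreviation "\<Omega> \<equiv> bandit_space D PG"
abbreviation "hist \<equiv> ape_hist K p c"
abbreviation "MR \<equiv> PiM UNIV (\<lambda>ta :: nat \<times> nat. D (snd ta))"
abbreviation "MG \<equiv> PiM UNIV (\<lambda>_ :: nat \<times> nat. PG)"

sublocale MR: product_prob_space "\<lambda>ta :: nat \<times> nat. D (snd ta)" UNIV
  by (intro product_prob_spaceI prob_D)

sublocale MG: product_prob_space "\<lambda>_ :: nat \<times> nat. PG" UNIV
  by (intro product_prob_spaceI prob_PG)

sublocale RG: pair_prob_space MR MG ..

lemma prob_space_\<Omega>: "prob_space \<Omega>"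
  unfolding bandit_space_def by (rule RG.prob_space_axioms)

sublocale \<Omega>: prob_space \<Omega> by (rule prob_space_\<Omega>)

lemma measurable_reward [measurable]: "(\<lambda>\<omega>. fst \<omega> i) \<in> borel_measurable \<Omega>"
proof -
  have "(\<lambda>\<omega>. fst \<omega> i) \<in> \<Omega> \<rightarrow>\<^sub>M D (snd i)" unfolding bandit_space_def by measurable
  then show ?thesis by (simp cong: measurable_cong_sets add: sets_D sets_PG)
qed

lemma measurable_perturbation [measurable]: "(\<lambda>\<omega>. snd \<omega> i) \<in> borel_measurable \<Omega>"
proof -
  have "(\<lambda>\<omega>. snd \<omega> i) \<in> \<Omega> \<rightarrow>\<^sub>M PG" unfolding bandit_space_def by measurable
  then show ?thesis by (simp cong: measurable_cong_sets add: sets_D sets_PG)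
qed

lemma measurable_upd_reward:
  "(\<lambda>(\<omega>, x). (fun_upd (fst \<omega>) i x, snd \<omega>)) \<in> \<Omega> \<Otimes>\<^sub>M D (snd i) \<rightarrow>\<^sub>M \<Omega>"
proof -
  have "(\<lambda>z. fun_upd (fst (fst z)) i (snd z)) \<in> (MR \<Otimes>\<^sub>M MG) \<Otimes>\<^sub>M D (snd i) \<rightarrow>\<^sub>M MR"
    by (rule measurable_fun_upd[of _ UNIV]) (auto, measurable)
  then show ?thesis unfolding bandit_space_def split_beta' by measurable
qed

lemma measurable_upd_perturbation:
  "(\<lambda>(\<omega>, x). (fst \<omega>, fun_upd (snd \<omega>) i x)) \<in> \<Omega> \<Otimes>\<^sub>M PG \<rightarrow>\<^sub>M \<Omega>"
proof -
  have "(\<lambda>z. fun_upd (snd (fst z)) i (snd z)) \<in> (MR \<Otimes>\<^sub>M MG) \<Otimes>\<^sub>M PG \<rightarrow>\<^sub>M MG"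
    by (rule measurable_fun_upd[of _ UNIV]) (auto, measurable)
  then show ?thesis unfolding bandit_space_def split_beta' by measurable
qed

text \<open>Plays the part of conditioning on everything except one reward: the inner integral
  redraws coordinate i while all others stay fixed.\<close>

lemma nn_integral_upd_reward:
  assumes f [measurable]: "f \<in> borel_measurable \<Omega>"
  shows "(\<integral>\<^sup>+\<omega>. f \<omega> \<partial>\<Omega>) = (\<integral>\<^sup>+\<omega>. (\<integral>\<^sup>+x. f (fun_upd (fst \<omega>) i x, snd \<omega>) \<partial>D (snd i)) \<partial>\<Omega>)"
proof -
  have f' [measurable]: "f \<in> borel_measurable (MR \<Otimes>\<^sub>M MG)" using f by (simp add: bandit_space_def)
  have "(\<lambda>z. f (fun_upd (fst (fst z)) i (snd z), snd (fst z))) \<in> borel_measurable (\<Omega> \<Otimes>\<^sub>M D (snd i))"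
    using measurable_compose[OF measurable_upd_reward f] by (simp add: split_beta')
  then have g: "(\<lambda>\<omega>. \<integral>\<^sup>+x. f (fun_upd (fst \<omega>) i x, snd \<omega>) \<partial>D (snd i)) \<in> borel_measurable (MR \<Otimes>\<^sub>M MG)"
    using sigma_finite_measure.borel_measurable_nn_integral[OF prob_space_imp_sigma_finite[OF prob_D], of "\<lambda>\<omega> x. f (fun_upd (fst \<omega>) i x, snd \<omega>)" \<Omega>]
    by (simp add: split_beta' bandit_space_def)
  have "(\<integral>\<^sup>+\<omega>. f \<omega> \<partial>\<Omega>) = (\<integral>\<^sup>+G. (\<integral>\<^sup>+R. f (R, G) \<partial>MR) \<partial>MG)"
    unfolding bandit_space_def by (rule RG.nn_integral_snd[symmetric]) measurable
  also have "\<dots> = (\<integral>\<^sup>+G. (\<integral>\<^sup>+R. (\<integral>\<^sup>+x. f (fun_upd R i x, G) \<partial>D (snd i)) \<partial>MR) \<partial>MG)"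
    by (intro nn_integral_cong MR.nn_integral_PiM_fun_upd) auto
  also have "\<dots> = (\<integral>\<^sup>+\<omega>. (\<integral>\<^sup>+x. f (fun_upd (fst \<omega>) i x, snd \<omega>) \<partial>D (snd i)) \<partial>\<Omega>)"
    unfolding bandit_space_def using RG.nn_integral_snd[OF g] by simp
  finally show ?thesis .
qed

lemma nn_integral_upd_perturbation:
  assumes f [measurable]: "f \<in> borel_measurable \<Omega>"
  shows "(\<integral>\<^sup>+\<omega>. f \<omega> \<partial>\<Omega>) = (\<integral>\<^sup>+\<omega>. (\<integral>\<^sup>+x. f (fst \<omega>, fun_upd (snd \<omega>) i x) \<partial>PG) \<partial>\<Omega>)"
proof -
  have f' [measurable]: "f \<in> borel_measurable (MR \<Otimes>\<^sub>M MG)" using f by (simp add: bandit_space_def)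
  have "(\<lambda>z. f (fst (fst z), fun_upd (snd (fst z)) i (snd z))) \<in> borel_measurable (\<Omega> \<Otimes>\<^sub>M PG)"
    using measurable_compose[OF measurable_upd_perturbation f] by (simp add: split_beta')
  then have g: "(\<lambda>\<omega>. \<integral>\<^sup>+x. f (fst \<omega>, fun_upd (snd \<omega>) i x) \<partial>PG) \<in> borel_measurable (MR \<Otimes>\<^sub>M MG)"
    using sigma_finite_measure.borel_measurable_nn_integral[OF prob_space_imp_sigma_finite[OF prob_PG], of "\<lambda>\<omega> x. f (fst \<omega>, fun_upd (snd \<omega>) i x)" \<Omega>]
    by (simp add: split_beta' bandit_space_def)
  have "(\<integral>\<^sup>+\<omega>. f \<omega> \<partial>\<Omega>) = (\<integral>\<^sup>+R. (\<integral>\<^sup>+G. f (R, G) \<partial>MG) \<partial>MR)"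
    unfolding bandit_space_def by (rule MG.P.nn_integral_fst[symmetric]) measurable
  also have "\<dots> = (\<integral>\<^sup>+R. (\<integral>\<^sup>+G. (\<integral>\<^sup>+x. f (R, fun_upd G i x) \<partial>PG) \<partial>MG) \<partial>MR)"
    by (intro nn_integral_cong MG.nn_integral_PiM_fun_upd) auto
  also have "\<dots> = (\<integral>\<^sup>+\<omega>. (\<integral>\<^sup>+x. f (fst \<omega>, fun_upd (snd \<omega>) i x) \<partial>PG) \<partial>\<Omega>)"
    unfolding bandit_space_def using MG.P.nn_integral_fst[OF g] by simp
  finally show ?thesis .
qed

lemma emeasure_perturbation_gt: "emeasure \<Omega> {\<omega>\<in>space \<Omega>. z < snd \<omega> i} = ennreal (1 - F z)"
proof -
  have "emeasure \<Omega> {\<omega>\<in>space \<Omega>. z < snd \<omega> i}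
      = (\<integral>\<^sup>+\<omega>. indicator {\<omega>\<in>space \<Omega>. z < snd \<omega> i} \<omega> \<partial>\<Omega>)" by simp
  also have "\<dots> = (\<integral>\<^sup>+\<omega>. indicator {z<..} (snd \<omega> i) \<partial>\<Omega>)"
    by (intro nn_integral_cong) (auto split: split_indicator)
  also have "\<dots> = (\<integral>\<^sup>+\<omega>. (\<integral>\<^sup>+x. indicator {z<..} x \<partial>PG) \<partial>\<Omega>)"
    by (subst nn_integral_upd_perturbation[where i = i]) auto
  also have "\<dots> = ennreal (1 - F z)"
    by (simp add: emeasure_PG_greaterThan \<Omega>.emeasure_space_1)
  finally show ?thesis .
qed

section \<open>Dependence of the history on rewards and perturbations\<close>

lemma length_hist [simp]: "length (hist R G t) = t"
  by (induction t) (simp_all add: Let_def)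

lemma take_hist: "k \<le> t \<Longrightarrow> take k (hist R G t) = hist R G k"
proof (induction t)
  case (Suc t)
  then show ?case by (cases "k = Suc t") (simp_all add: Let_def)
qed simp

lemma nth_hist: "k < t \<Longrightarrow> hist R G t ! k = ape_choose K p c R G (Suc k) (hist R G k)"
proof -
  assume "k < t"
  then have "hist R G t ! k = hist R G (Suc k) ! k"
    using take_hist[of "Suc k" t R G] by (metis Suc_leI lessI nth_take)
  then show ?thesis by (simp add: Let_def nth_append)
qed

lemma ape_index_cong:
  assumes "\<And>s. s \<le> length h \<Longrightarrow> R (s, a) = R' (s, a)" "G (t, a) = G' (t, a)"
  shows "ape_index p c R G t h a = ape_index p c R' G' t h a"
  using assms unfolding ape_index_def ape_est_def by (auto intro!: sum.cong simp: Let_def)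

text \<open>The asymmetry matters: the action of round t uses the perturbations of round t but only
  rewards of earlier rounds. So the reward of round t can be redrawn without changing the first t
  actions.\<close>

lemma hist_cong:
  assumes "\<And>s a. s < t \<Longrightarrow> R (s, a) = R' (s, a)" "\<And>s a. s \<le> t \<Longrightarrow> G (s, a) = G' (s, a)"
  shows "hist R G t = hist R' G' t"
  using assms
proof (induction t)
  case (Suc t)
  then have "hist R G t = hist R' G' t" by simp
  moreover have "ape_index p c R G (Suc t) (hist R' G' t) = ape_index p c R' G' (Suc t) (hist R' G' t)"
    using Suc.prems by (intro ext ape_index_cong) auto
  ultimately show ?case by (simp add: Let_def ape_choose_def)
qed simp

lemma ape_choose_props:
  assumes "K < t"
  shows "ape_choose K p c R G t h < K"
    and "b < K \<Longrightarrow> ape_index p c R G t h b \<le> ape_index p c R G t h (ape_choose K p c R G t h)"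
proof -
  let ?f = "ape_index p c R G t h"
  have "Max (?f ` {..<K}) \<in> ?f ` {..<K}" using astar by (intro Max_in) auto
  then obtain a where "a < K" "?f a = Max (?f ` {..<K})" by auto
  then have "a < K \<and> (\<forall>b<K. ?f b \<le> ?f a)" by auto
  then have "(LEAST a. a < K \<and> (\<forall>b<K. ?f b \<le> ?f a)) < K \<and>
      (\<forall>b<K. ?f b \<le> ?f (LEAST a. a < K \<and> (\<forall>b<K. ?f b \<le> ?f a)))"
    by (rule LeastI)
  then show "ape_choose K p c R G t h < K"
    and "b < K \<Longrightarrow> ape_index p c R G t h b \<le> ape_index p c R G t h (ape_choose K p c R G t h)"
    using assms by (auto simp: ape_choose_def)
qed

lemma nth_hist_initial: "k < t \<Longrightarrow> k < K \<Longrightarrow> hist R G t ! k = k"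
  by (simp add: nth_hist ape_choose_def)

lemma nth_hist_less: "k < t \<Longrightarrow> hist R G t ! k < K"
  by (cases "k < K") (simp_all add: nth_hist_initial nth_hist ape_choose_props)

lemma npulls_hist_pos:
  assumes "K \<le> t" "a < K"
  shows "1 \<le> npulls (hist R G t) a"
proof -
  have "a \<in> set (hist R G t)" using assms nth_hist_initial[of a t R G]
    by (metis length_hist nth_mem order_less_le_trans)
  then show ?thesis unfolding npulls_def
    by (metis (mono_tags, lifting) filter_empty_conv length_0_conv less_one not_le)
qed

lemma measurable_ape_index [measurable]:
  "(\<lambda>\<omega>. ape_index p c (fst \<omega>) (snd \<omega>) t h a) \<in> borel_measurable \<Omega>"
  unfolding ape_index_def ape_est_def ape_beta_def Let_def by measurable

lemma measurable_ape_choose [measurable]: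
  "(\<lambda>\<omega>. ape_choose K p c (fst \<omega>) (snd \<omega>) t h) \<in> \<Omega> \<rightarrow>\<^sub>M count_space UNIV"
  unfolding ape_choose_def by measurable

text \<open>Histories form a countable type, so measurability of the choice for each fixed history
  suffices.\<close>

lemma measurable_hist [measurable]: "(\<lambda>\<omega>. hist (fst \<omega>) (snd \<omega>) t) \<in> \<Omega> \<rightarrow>\<^sub>M count_space UNIV"
proof (induction t)
  case (Suc t)
  have "(\<lambda>\<omega>. h @ [ape_choose K p c (fst \<omega>) (snd \<omega>) (Suc t) h]) \<in> \<Omega> \<rightarrow>\<^sub>M count_space UNIV" for h
    by measurable
  from measurable_compose_countable[OF this Suc] show ?case by (simp add: Let_def)
qed simp

end

section \<open>Exponential tail bounds for the estimators\<close>

text \<open>The first \<^term>\<open>n\<close> pulls of arm \<^term>\<open>a\<close>, frozen from then on, so that the sum over the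
  whole history can stand for the sum at the unknown round in which \<^term>\<open>n\<close> pulls are reached.\<close>
definition psum :: "real \<Rightarrow> real \<Rightarrow> nat \<Rightarrow> nat \<Rightarrow> (nat \<times> nat \<Rightarrow> real) \<Rightarrow> nat list \<Rightarrow> real" where
  "psum p c n a R h = (\<Sum>k<length h. if h ! k = a \<and> npulls (take k h) a < n
      then psi p (R (Suc k, a) / (c * real n powr (1 / p))) else 0)"

lemma npulls_take_less:
  assumes "k < t" "t \<le> length h" "h ! k = a"
  shows "npulls (take k h) a < npulls (take t h) a"
proof -
  have "npulls (take (Suc k) h) a = npulls (take k h) a + 1"
    using assms by (simp add: take_Suc_conv_app_nth npulls_snoc)
  moreover have "take (Suc k) h = take (Suc k) (take t h)" using assms by simp
  ultimately show ?thesis using npulls_take_le[of "Suc k" "take t h" a] by simp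
qed

lemma npulls_take_mono: "t \<le> k \<Longrightarrow> npulls (take t h) a \<le> npulls (take k h) a"
  using npulls_take_le[of t "take k h" a] by (simp add: min_absorb1)

text \<open>Pulls after round t already see at least n earlier ones and are frozen out, while those
  before see fewer than n; so the sum frozen at n, read off at the end, is the one used at round
  t.\<close>

lemma ape_est_take:
  assumes t: "t \<le> length h" and n: "npulls (take t h) a = n"
  shows "ape_est p c R (take t h) a = c / real n powr (1 - 1 / p) * psum p c n a R h"
proof -
  let ?f = "\<lambda>k. psi p (R (Suc k, a) / (c * real n powr (1 / p)))"
  have "psum p c n a R h = (\<Sum>k<t. if h ! k = a then ?f k else 0)"
    unfolding psum_def
  proof (rule sum.mono_neutral_cong_right)
    show "\<forall>k\<in>{..<length h} - {..<t}. (if h ! k = a \<and> npulls (take k h) a < n then ?f k else 0) = 0"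
      using npulls_take_mono[of t _ h a] n by (auto simp: leD)
  qed (use t n npulls_take_less[of _ t h a] in auto)
  then show ?thesis using t n by (simp add: ape_est_def Let_def min_absorb2)
qed

context bandit
begin

lemma integrable_reward:
  assumes a: "a < K"
  shows "integrable (D a) (\<lambda>x. x)" "integrable (D a) (\<lambda>x. \<bar>x\<bar> powr p)"
    and "(\<integral>x. \<bar>x\<bar> powr p \<partial>D a) \<le> max \<nu> 0"
proof -
  interpret D: prob_space "D a" by (rule prob_D)
  show I: "integrable (D a) (\<lambda>x. \<bar>x\<bar> powr p)"
  proof (rule integrableI_nonneg)
    show "(\<lambda>x. \<bar>x\<bar> powr p) \<in> borel_measurable (D a)"
      unfolding measurable_cong_sets[OF sets_D refl] by measurable
    show "(\<integral>\<^sup>+x. ennreal (\<bar>x\<bar> powr p) \<partial>D a) < \<infinity>"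
      using le_less_trans[OF moment[OF a] ennreal_less_top] by (simp only: infinity_ennreal_def)
  qed simp
  have "\<bar>x\<bar> \<le> 1 + \<bar>x\<bar> powr p" for x :: real
  proof (cases "\<bar>x\<bar> \<le> 1")
    case False
    then have "\<bar>x\<bar> powr 1 \<le> \<bar>x\<bar> powr p" using p by (intro powr_mono) auto
    with False show ?thesis by (simp add: abs_if split: if_splits)
  qed (simp add: add_increasing2)
  then have le: "norm x \<le> norm (1 + \<bar>x\<bar> powr p)" for x :: real
    by (metis abs_ge_self order_trans real_norm_def)
  show "integrable (D a) (\<lambda>x. x)"
  proof (rule Bochner_Integration.integrable_bound)
    show "integrable (D a) (\<lambda>x. 1 + \<bar>x\<bar> powr p)" using I by (intro Bochner_Integration.integrable_add) simp_all
    show "(\<lambda>x. x) \<in> borel_measurable (D a)" unfolding measurable_cong_sets[OF sets_D refl] by measurable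
    show "AE x in D a. norm x \<le> norm (1 + \<bar>x\<bar> powr p)" using le by (intro AE_I2)
  qed
  have "ennreal (\<integral>x. \<bar>x\<bar> powr p \<partial>D a) \<le> ennreal \<nu>"
    using moment[OF a] I by (simp add: nn_integral_eq_integral)
  then show "(\<integral>x. \<bar>x\<bar> powr p \<partial>D a) \<le> max \<nu> 0"
    by (auto simp: ennreal_le_iff2)
qed

text \<open>The total price of the p-th moments over n pulls: at scale l = c n^(1/p) one has l^p =
  c^p n, so each pull contributes Bc / n.\<close>

definition Bc :: real where "Bc = bp p * max \<nu> 0 / c powr p"

text \<open>\<open>exp_psi_le\<close> bounds the integrand by a constant, a linear and a p-th power
  term, so only the mean and the p-th moment enter; 1 + x <= exp x restores exponential form. The
  sign \<sigma> selects the upper or the lower tail.\<close>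

lemma nn_integral_exp_psi:
  assumes a: "a < K" and n: "1 \<le> n" and \<sigma>: "\<sigma> = 1 \<or> \<sigma> = - 1"
  defines "l \<equiv> c * real n powr (1 / p)"
  shows "(\<integral>\<^sup>+x. ennreal (exp (\<sigma> * psi p (x / l))) \<partial>D a)
    \<le> ennreal (exp (\<sigma> * mean_reward D a / l + Bc / real n))"
proof -
  interpret D: prob_space "D a" by (rule prob_D)
  have l: "0 < l" using c n by (simp add: l_def)
  note I = integrable_reward[OF a]
  let ?f = "\<lambda>x. 1 + \<sigma> / l * x + bp p / l powr p * \<bar>x\<bar> powr p"
  have le: "exp (\<sigma> * psi p (x / l)) \<le> ?f x" for x
    using exp_psi_le[OF p, of "\<sigma> * (x / l)"] \<sigma> l
    by (auto simp: psi_uminus abs_mult powr_divide abs_divide)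
  have f: "integrable (D a) ?f" using I by simp
  have "(\<integral>\<^sup>+x. ennreal (exp (\<sigma> * psi p (x / l))) \<partial>D a) \<le> (\<integral>\<^sup>+x. ennreal (?f x) \<partial>D a)"
    using le by (intro nn_integral_mono ennreal_leI)
  also have "\<dots> = ennreal (\<integral>x. ?f x \<partial>D a)"
    using f le by (intro nn_integral_eq_integral) (auto intro: order_trans[OF exp_ge_zero])
  also have "(\<integral>x. ?f x \<partial>D a) = 1 + \<sigma> / l * mean_reward D a + bp p / l powr p * (\<integral>x. \<bar>x\<bar> powr p \<partial>D a)"
    using I by (simp add: mean_reward_def D.prob_space)
  also have "\<dots> \<le> 1 + (\<sigma> * mean_reward D a / l + Bc / real n)"
  proof -
    have "bp p / l powr p * (\<integral>x. \<bar>x\<bar> powr p \<partial>D a) \<le> bp p / l powr p * max \<nu> 0"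
      using I(3) bp_pos[OF p] by (intro mult_left_mono) auto
    also have "\<dots> = Bc / real n"
      using n p c by (simp add: Bc_def l_def powr_mult powr_powr)
    finally show ?thesis by simp
  qed
  also have "\<dots> \<le> exp (\<sigma> * mean_reward D a / l + Bc / real n)"
    by (rule exp_ge_add_one_self)
  finally show ?thesis by (simp add: ennreal_leI)
qed

lemma measurable_psum [measurable]:
  "(\<lambda>\<omega>. psum p c n a (fst \<omega>) (hist (fst \<omega>) (snd \<omega>) t)) \<in> borel_measurable \<Omega>"
proof -
  have "(\<lambda>\<omega>. psum p c n a (fst \<omega>) h) \<in> borel_measurable \<Omega>" for h
    unfolding psum_def by measurable
  then show ?thesis by (rule measurable_compose_countable) measurable
qed

lemma psum_snoc:
  "psum p c n a R (h @ [b]) = psum p c n a R h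
    + (if b = a \<and> npulls h a < n then psi p (R (Suc (length h), a) / (c * real n powr (1 / p))) else 0)"
  unfolding psum_def by (simp add: nth_append)

lemma psum_cong:
  "(\<And>s. s \<le> length h \<Longrightarrow> R (s, a) = R' (s, a)) \<Longrightarrow> psum p c n a R h = psum p c n a R' h"
  unfolding psum_def by (intro sum.cong) auto

text \<open>\<kappa> is the largest log-growth of one counted pull. The compensator runs over
  \<open>min n (npulls ..)\<close>, the number of counted pulls, so the weight stands still once n
  pulls are made.\<close>

lemma nn_integral_exp_psum:
  assumes a: "a < K" and n: "1 \<le> n" and \<sigma>: "\<sigma> = 1 \<or> \<sigma> = - 1"
  defines "\<kappa> \<equiv> \<sigma> * mean_reward D a / (c * real n powr (1 / p)) + Bc / real n"
  shows "(\<integral>\<^sup>+\<omega>. ennreal (exp (\<sigma> * psum p c n a (fst \<omega>) (hist (fst \<omega>) (snd \<omega>) t)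
      - \<kappa> * real (min n (npulls (hist (fst \<omega>) (snd \<omega>) t) a)))) \<partial>\<Omega>) \<le> 1"
proof (induction t)
  case 0
  then show ?case by (simp add: psum_def \<Omega>.emeasure_space_1)
next
  case (Suc t)
  define W where "W = (\<lambda>(\<omega> :: (nat \<times> nat \<Rightarrow> real) \<times> (nat \<times> nat \<Rightarrow> real)) h. ennreal (exp (\<sigma> * psum p c n a (fst \<omega>) h - \<kappa> * real (min n (npulls h a)))))"
  define H where "H \<omega> = hist (fst \<omega>) (snd \<omega>)" for \<omega>
  have W_meas [measurable]: "(\<lambda>\<omega>. W \<omega> (H \<omega> s)) \<in> borel_measurable \<Omega>" for s
    unfolding W_def H_def by measurable
  \<comment> \<open>The redrawn coordinate is the reward that arm \<open>a\<close> would give in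
    round t + 1, whether or not it is played there; the action of that round does not depend on
    it.\<close>
  have "(\<integral>\<^sup>+\<omega>. W \<omega> (H \<omega> (Suc t)) \<partial>\<Omega>)
      = (\<integral>\<^sup>+\<omega>. (\<integral>\<^sup>+x. W (fun_upd (fst \<omega>) (Suc t, a) x, snd \<omega>) (H (fun_upd (fst \<omega>) (Suc t, a) x, snd \<omega>) (Suc t))
          \<partial>D a) \<partial>\<Omega>)"
    by (subst nn_integral_upd_reward[where i = "(Suc t, a)"]) auto
  also have "\<dots> \<le> (\<integral>\<^sup>+\<omega>. W \<omega> (H \<omega> t) \<partial>\<Omega>)"
  proof (rule nn_integral_mono)
    fix \<omega>
    interpret D: prob_space "D a" by (rule prob_D)
    define h where "h = H \<omega> t"
    define b where "b = ape_choose K p c (fst \<omega>) (snd \<omega>) (Suc t) h"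
    let ?\<omega> = "\<lambda>x. (fun_upd (fst \<omega>) (Suc t, a) x, snd \<omega>)"
    let ?l = "c * real n powr (1 / p)"
    have len: "length h = t" by (simp add: h_def H_def)
    have Hx: "H (?\<omega> x) (Suc t) = h @ [b]" for x
    proof -
      have "H (?\<omega> x) (Suc t) = H \<omega> (Suc t)"
        unfolding H_def by (rule hist_cong) auto
      also have "\<dots> = h @ [b]" by (simp add: H_def h_def b_def Let_def)
      finally show ?thesis .
    qed
    have ps: "psum p c n a (fst (?\<omega> x)) h = psum p c n a (fst \<omega>) h" for x
      by (rule psum_cong) (auto simp: len)
    show "(\<integral>\<^sup>+x. W (?\<omega> x) (H (?\<omega> x) (Suc t)) \<partial>D a) \<le> W \<omega> (H \<omega> t)"
    \<comment> \<open>Only a counted pull changes the weight, by a factor of mean at most exp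
      \<kappa> against the compensation exp (- \<kappa>).\<close>
    proof (cases "b = a \<and> npulls h a < n")
      case True
      then have m: "min n (npulls (h @ [a]) a) = Suc (npulls h a)" "min n (npulls h a) = npulls h a"
        by (auto simp: npulls_snoc)
      have "W (?\<omega> x) (h @ [b]) = W \<omega> h * ennreal (exp (- \<kappa>)) * ennreal (exp (\<sigma> * psi p (x / ?l)))" for x
        using True by (simp add: W_def psum_snoc ps[simplified] len m flip: ennreal_mult exp_add)
           (simp add: algebra_simps)
      then have "(\<integral>\<^sup>+x. W (?\<omega> x) (H (?\<omega> x) (Suc t)) \<partial>D a)
          = W \<omega> h * ennreal (exp (- \<kappa>)) * (\<integral>\<^sup>+x. ennreal (exp (\<sigma> * psi p (x / ?l))) \<partial>D a)"
        by (simp add: Hx nn_integral_cmult)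
      also have "\<dots> \<le> W \<omega> h * ennreal (exp (- \<kappa>)) * ennreal (exp \<kappa>)"
        unfolding \<kappa>_def by (intro mult_left_mono nn_integral_exp_psi a n \<sigma>) auto
      also have "\<dots> = W \<omega> h * (ennreal (exp (- \<kappa>)) * ennreal (exp \<kappa>))" by (simp add: mult.assoc)
      also have "ennreal (exp (- \<kappa>)) * ennreal (exp \<kappa>) = 1" by (simp flip: ennreal_mult exp_add)
      finally show ?thesis unfolding h_def mult_1_right .
    next
      case False
      then have "W (?\<omega> x) (h @ [b]) = W \<omega> h" for x
        by (auto simp: W_def psum_snoc ps[simplified] npulls_snoc)
      then show ?thesis by (simp add: Hx D.emeasure_space_1 h_def)
    qed
  qed
  also have "\<dots> \<le> 1" using Suc unfolding W_def H_def .
  finally show ?case unfolding W_def H_def .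
qed

text \<open>Markov's inequality for the weight of \<open>nn_integral_exp_psum\<close>. On the event
  at least n pulls have been made, so the random compensator equals the fixed number \<kappa> n;
  this removes the effect of adaptive sampling.\<close>

lemma emeasure_psum_ge:
  assumes a: "a < K" and n: "1 \<le> n" and \<sigma>: "\<sigma> = 1 \<or> \<sigma> = - 1"
  shows "emeasure \<Omega> {\<omega>\<in>space \<Omega>. n \<le> npulls (hist (fst \<omega>) (snd \<omega>) t) a
      \<and> s \<le> \<sigma> * psum p c n a (fst \<omega>) (hist (fst \<omega>) (snd \<omega>) t)}
    \<le> ennreal (exp (\<sigma> * mean_reward D a * real n powr (1 - 1 / p) / c + Bc - s))"
proof -
  define \<kappa> where "\<kappa> = \<sigma> * mean_reward D a / (c * real n powr (1 / p)) + Bc / real n"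
  have nk: "\<kappa> * real n = \<sigma> * mean_reward D a * real n powr (1 - 1 / p) / c + Bc"
    using n c by (simp add: \<kappa>_def powr_diff field_simps)
  let ?A = "{\<omega>\<in>space \<Omega>. n \<le> npulls (hist (fst \<omega>) (snd \<omega>) t) a
      \<and> s \<le> \<sigma> * psum p c n a (fst \<omega>) (hist (fst \<omega>) (snd \<omega>) t)}"
  let ?W = "\<lambda>\<omega>. ennreal (exp (\<sigma> * psum p c n a (fst \<omega>) (hist (fst \<omega>) (snd \<omega>) t)
      - \<kappa> * real (min n (npulls (hist (fst \<omega>) (snd \<omega>) t) a))))"
  have A [measurable]: "?A \<in> sets \<Omega>" by measurable
  have "emeasure \<Omega> ?A = (\<integral>\<^sup>+\<omega>. indicator ?A \<omega> \<partial>\<Omega>)" by simp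
  also have "\<dots> \<le> (\<integral>\<^sup>+\<omega>. ennreal (exp (\<kappa> * real n - s)) * ?W \<omega> \<partial>\<Omega>)"
    by (intro nn_integral_mono) (auto simp: min_absorb1 split: split_indicator simp flip: ennreal_mult exp_add)
  also have "\<dots> = ennreal (exp (\<kappa> * real n - s)) * (\<integral>\<^sup>+\<omega>. ?W \<omega> \<partial>\<Omega>)"
    by (rule nn_integral_cmult) measurable
  also have "\<dots> \<le> ennreal (exp (\<kappa> * real n - s)) * 1"
    unfolding \<kappa>_def by (intro mult_left_mono nn_integral_exp_psum a n \<sigma>) auto
  finally show ?thesis by (simp add: nk)
qed

end

section \<open>Counting pulls\<close>

text \<open>Moves from random pull times to the fixed range n = 1, ..., \<open>length h\<close> with
  a random condition on n, so that expectations can be taken term by term. Past the initial rounds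
  the count is at least 1, hence no n = 0 term.\<close>

lemma sum_pulls_le:
  fixes f g :: "nat \<Rightarrow> ennreal"
  assumes gf: "\<And>k. k < length h \<Longrightarrow> h ! k = a \<Longrightarrow> K \<le> k \<Longrightarrow> g k \<le> f (npulls (take k h) a)"
    and pos: "\<And>k. k < length h \<Longrightarrow> K \<le> k \<Longrightarrow> 1 \<le> npulls (take k h) a"
  shows "(\<Sum>k<length h. if h ! k = a \<and> K \<le> k then g k else 0)
    \<le> (\<Sum>n=1..length h. if n \<le> npulls h a then f n else 0)"
proof -
  have "(\<Sum>k<length h. if h ! k = a \<and> K \<le> k then g k else 0)
      \<le> (\<Sum>k<length h. if h ! k = a then (\<lambda>n. if 1 \<le> n then f n else 0) (npulls (take k h) a) else 0)"
    using gf pos by (intro sum_mono) auto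
  also have "\<dots> = (\<Sum>n<npulls h a. if 1 \<le> n then f n else 0)"
    by (rule sum_pulls)
  also have "\<dots> = (\<Sum>n\<in>{1..<npulls h a}. f n)"
    by (intro sum.mono_neutral_cong_right) auto
  also have "\<dots> = (\<Sum>n\<in>{1..<npulls h a}. if n \<le> npulls h a then f n else 0)"
    by (intro sum.cong) auto
  also have "\<dots> \<le> (\<Sum>n=1..length h. if n \<le> npulls h a then f n else 0)"
    using npulls_le_length[of h a] by (intro sum_mono2) auto
  finally show ?thesis .
qed

lemma sum_less_bound:
  assumes "0 \<le> L"
  shows "(\<Sum>n=1..N. if real n < L then 1 else 0 :: real) \<le> L"
proof -
  have "(\<Sum>n=1..N. if real n < L then 1 else 0 :: real) = real (card {n\<in>{1..N}. real n < L})"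
    by (subst sum.inter_filter[symmetric]) auto
  also have "\<dots> \<le> real (card {1..nat \<lfloor>L\<rfloor>})"
    by (intro of_nat_mono card_mono) (auto simp: le_nat_iff le_floor_iff)
  also have "\<dots> \<le> L" using of_nat_floor[OF assms] by simp
  finally show ?thesis .
qed

lemma nn_integral_if_eq_emeasure:
  assumes [measurable]: "Measurable.pred M P"
  shows "(\<integral>\<^sup>+x. (if P x then 1 else 0) \<partial>M) = emeasure M {x\<in>space M. P x}"
proof -
  have "(\<integral>\<^sup>+x. (if P x then 1 else 0) \<partial>M) = (\<integral>\<^sup>+x. indicator {x\<in>space M. P x} x \<partial>M)"
    by (intro nn_integral_cong) auto
  then show ?thesis by simp
qed

lemma powr_le_of_inverse_powr_le:
  fixes q :: real
  assumes "0 < q" "0 \<le> x" "0 \<le> L" "L powr q \<le> x"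
  shows "L \<le> x powr (1 / q)"
proof -
  have "(L powr q) powr (1 / q) \<le> x powr (1 / q)" using assms by (intro powr_mono2) auto
  then show ?thesis using assms by (simp add: powr_powr split: if_splits)
qed

context bandit
begin

text \<open>The conjugate exponent of p. The bonus decays like c n^(-1/q), so it falls to size
  \<delta> after about (c / \<delta>)^q pulls.\<close>

definition q :: real where "q = p / (p - 1)"

lemma q_props: "1 - 1 / p = 1 / q" "0 < q" "q - 1 = 1 / (p - 1)"
  using p by (auto simp: q_def field_simps)

text \<open>Shifted by one: \<open>act k\<close> is the action of round k + 1, chosen from the
  history of k rounds, so \<open>K \<le> k\<close> means that the initial rounds are over.\<close>

definition act :: "nat \<Rightarrow> (nat \<times> nat \<Rightarrow> real) \<times> (nat \<times> nat \<Rightarrow> real) \<Rightarrow> nat" where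
  "act k \<omega> = ape_choose K p c (fst \<omega>) (snd \<omega>) (Suc k) (hist (fst \<omega>) (snd \<omega>) k)"

lemma measurable_act [measurable]: "act k \<in> \<Omega> \<rightarrow>\<^sub>M count_space UNIV"
proof -
  have "(\<lambda>\<omega>. ape_choose K p c (fst \<omega>) (snd \<omega>) (Suc k) h) \<in> \<Omega> \<rightarrow>\<^sub>M count_space UNIV" for h
    by measurable
  from measurable_compose_countable[OF this measurable_hist] show ?thesis by (simp add: act_def[abs_def])
qed

lemma measurable_index_hist [measurable]:
  "(\<lambda>\<omega>. ape_index p c (fst \<omega>) (snd \<omega>) t (hist (fst \<omega>) (snd \<omega>) k) a) \<in> borel_measurable \<Omega>"
  by (rule measurable_compose_countable[OF measurable_ape_index measurable_hist])

lemma measurable_est_hist [measurable]: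
  "(\<lambda>\<omega>. ape_est p c (fst \<omega>) (hist (fst \<omega>) (snd \<omega>) k) a) \<in> borel_measurable \<Omega>"
proof -
  have "(\<lambda>\<omega>. ape_est p c (fst \<omega>) h a) \<in> borel_measurable \<Omega>" for h
    unfolding ape_est_def Let_def by measurable
  then show ?thesis by (rule measurable_compose_countable[OF _ measurable_hist])
qed

lemma measurable_beta_hist [measurable]:
  "(\<lambda>\<omega>. ape_beta p c (hist (fst \<omega>) (snd \<omega>) k) a) \<in> borel_measurable \<Omega>"
  by (rule measurable_compose_countable[OF _ measurable_hist]) measurable

lemma beta_pos: "K \<le> k \<Longrightarrow> a < K \<Longrightarrow> 0 < ape_beta p c (hist R G k) a"
  using npulls_hist_pos[of k a R G] c by (auto simp: ape_beta_def)

text \<open>The value that the perturbation of the optimal arm must exceed in round k + 1 for its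
  index to exceed y; it depends on the history of k rounds alone.\<close>

definition thr :: "nat \<Rightarrow> real \<Rightarrow> (nat \<times> nat \<Rightarrow> real) \<times> (nat \<times> nat \<Rightarrow> real) \<Rightarrow> real" where
  "thr k y \<omega> = (y - ape_est p c (fst \<omega>) (hist (fst \<omega>) (snd \<omega>) k) astar) / ape_beta p c (hist (fst \<omega>) (snd \<omega>) k) astar"

lemma measurable_thr [measurable]: "thr k y \<in> borel_measurable \<Omega>"
  unfolding thr_def by measurable

text \<open>Condition on everything but the perturbation of the optimal arm: that arm is played as soon
  as its perturbation exceeds the threshold, and the other event requires that it does not.\<close>
lemma nn_integral_low_index_le:
  assumes a: "a < K" "a \<noteq> astar" and k: "K \<le> k"
  shows "(\<integral>\<^sup>+\<omega>. (if act k \<omega> = a \<and> ape_index p c (fst \<omega>) (snd \<omega>) (Suc k) (hist (fst \<omega>) (snd \<omega>) k) a \<le> y then 1 else 0) \<partial>\<Omega>)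
    \<le> (\<integral>\<^sup>+\<omega>. ennreal (odds (thr k y \<omega>)) * (if act k \<omega> = astar then 1 else 0) \<partial>\<Omega>)"
proof -
  define i where "i = (Suc k, astar)"
  let ?low = "\<lambda>\<omega>. act k \<omega> = a \<and> ape_index p c (fst \<omega>) (snd \<omega>) (Suc k) (hist (fst \<omega>) (snd \<omega>) k) a \<le> y"
  let ?\<omega> = "\<lambda>\<omega> g. (fst \<omega>, fun_upd (snd \<omega>) i g)"
  have "(\<integral>\<^sup>+\<omega>. (if ?low \<omega> then 1 else 0) \<partial>\<Omega>) = (\<integral>\<^sup>+\<omega>. (\<integral>\<^sup>+g. (if ?low (?\<omega> \<omega> g) then 1 else 0) \<partial>PG) \<partial>\<Omega>)"
    by (rule nn_integral_upd_perturbation) measurable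
  also have "\<dots> \<le> (\<integral>\<^sup>+\<omega>. (\<integral>\<^sup>+g. ennreal (odds (thr k y (?\<omega> \<omega> g))) * (if act k (?\<omega> \<omega> g) = astar then 1 else 0) \<partial>PG) \<partial>\<Omega>)"
  proof (rule nn_integral_mono)
    fix \<omega>
    define h where "h = hist (fst \<omega>) (snd \<omega>) k"
    define z where "z = thr k y \<omega>"
    define idx where "idx g b = ape_index p c (fst \<omega>) (fun_upd (snd \<omega>) i g) (Suc k) h b" for g b
    have h: "hist (fst \<omega>) (fun_upd (snd \<omega>) i g) k = h" for g
      unfolding h_def by (rule hist_cong) (auto simp: i_def)
    have z: "thr k y (?\<omega> \<omega> g) = z" for g
      by (simp only: thr_def z_def fst_conv snd_conv h) (simp only: h_def)
    have act_less: "act k (?\<omega> \<omega> g) < K" for g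
      using k ape_choose_props(1)[of "Suc k"] unfolding act_def by auto
    have act_max: "idx g b \<le> idx g (act k (?\<omega> \<omega> g))" if "b < K" for g b
      using k that ape_choose_props(2)[of "Suc k"] unfolding act_def idx_def fst_conv snd_conv h by auto
    have idx_other: "idx g b = idx g' b" if "b \<noteq> astar" for g g' b
      unfolding idx_def using that by (intro ape_index_cong) (auto simp: i_def)
    have \<beta>: "0 < ape_beta p c h astar" unfolding h_def using beta_pos[OF k astar] .
    have idx_star: "y < idx g astar \<longleftrightarrow> z < g" for g
      using \<beta> unfolding idx_def z_def thr_def ape_index_def h_def[symmetric]
      by (simp add: i_def field_simps)
    have low: "?low (?\<omega> \<omega> g) \<longleftrightarrow> act k (?\<omega> \<omega> g) = a \<and> idx g a \<le> y" for g
      unfolding idx_def fst_conv snd_conv h ..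
    show "(\<integral>\<^sup>+g. (if ?low (?\<omega> \<omega> g) then 1 else 0) \<partial>PG)
        \<le> (\<integral>\<^sup>+g. ennreal (odds (thr k y (?\<omega> \<omega> g))) * (if act k (?\<omega> \<omega> g) = astar then 1 else 0) \<partial>PG)"
    proof (cases "\<exists>g. ?low (?\<omega> \<omega> g)")
      case False
      then have "\<not> ?low (?\<omega> \<omega> g)" for g by blast
      then show ?thesis by (simp only: if_False nn_integral_const mult_zero_left zero_le)
    next
      case True
      \<comment> \<open>One value g0 is enough: there arm \<open>a\<close> wins with index at most
        y, so every arm other than the optimal one has index at most y, and these indices do not
        depend on g.\<close>
      then obtain g0 where g0: "act k (?\<omega> \<omega> g0) = a" "idx g0 a \<le> y" unfolding low by blast
      have star: "act k (?\<omega> \<omega> g) = astar" if "z < g" for g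
      proof (rule ccontr)
        let ?b = "act k (?\<omega> \<omega> g)"
        assume b: "?b \<noteq> astar"
        have "idx g ?b \<le> y" using act_max[OF act_less[of g], of g0] g0 idx_other[OF b, of g g0] by simp
        moreover have "idx g astar \<le> idx g ?b" using act_max[OF astar] .
        ultimately show False using idx_star[of g] that by simp
      qed
      have le: "g \<le> z" if "?low (?\<omega> \<omega> g)" for g
        using that idx_star[of g] act_max[OF astar, of g] unfolding low by fastforce
      have "(\<integral>\<^sup>+g. (if ?low (?\<omega> \<omega> g) then 1 else 0) \<partial>PG) \<le> (\<integral>\<^sup>+g. indicator {..z} g \<partial>PG)"
        using le by (intro nn_integral_mono) (auto split: split_indicator)
      \<comment> \<open>F z = odds z * (1 - F z) trades missing the threshold for exceeding it,
        where the optimal arm is played.\<close>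
      also have "\<dots> = ennreal (odds z) * ennreal (1 - F z)"
        using F_less_1[of z] odds_nonneg[of z]
        by (simp add: emeasure_PG_atMost sets_PG odds_def flip: ennreal_mult')
      also have "\<dots> = ennreal (odds z) * (\<integral>\<^sup>+g. indicator {z<..} g \<partial>PG)"
        by (simp add: emeasure_PG_greaterThan sets_PG)
      also have "\<dots> = (\<integral>\<^sup>+g. ennreal (odds z) * indicator {z<..} g \<partial>PG)"
        by (rule nn_integral_cmult[symmetric]) (simp add: sets_PG)
      also have "\<dots> \<le> (\<integral>\<^sup>+g. ennreal (odds (thr k y (?\<omega> \<omega> g))) * (if act k (?\<omega> \<omega> g) = astar then 1 else 0) \<partial>PG)"
        unfolding z using star by (intro nn_integral_mono) (auto split: split_indicator)
      finally show ?thesis .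
    qed
  qed
  also have "\<dots> = (\<integral>\<^sup>+\<omega>. ennreal (odds (thr k y \<omega>)) * (if act k \<omega> = astar then 1 else 0) \<partial>\<Omega>)"
    by (rule nn_integral_upd_perturbation[symmetric]) measurable
  finally show ?thesis .
qed

lemma nth_hist_act: "k < T \<Longrightarrow> hist (fst \<omega>) (snd \<omega>) T ! k = act k \<omega>"
  by (simp add: nth_hist act_def)

lemma sum_act_le:
  fixes f g :: "nat \<Rightarrow> ennreal"
  assumes a: "a < K"
    and gf: "\<And>k. k < T \<Longrightarrow> act k \<omega> = a \<Longrightarrow> K \<le> k \<Longrightarrow> g k \<le> f (npulls (hist (fst \<omega>) (snd \<omega>) k) a)"
  shows "(\<Sum>k<T. if act k \<omega> = a \<and> K \<le> k then g k else 0)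
    \<le> (\<Sum>n=1..T. if n \<le> npulls (hist (fst \<omega>) (snd \<omega>) T) a then f n else 0)"
proof -
  let ?h = "hist (fst \<omega>) (snd \<omega>) T"
  have "(\<Sum>k<T. if act k \<omega> = a \<and> K \<le> k then g k else 0) = (\<Sum>k<length ?h. if ?h ! k = a \<and> K \<le> k then g k else 0)"
    by (intro sum.cong) (auto simp: nth_hist_act)
  also have "\<dots> \<le> (\<Sum>n=1..length ?h. if n \<le> npulls ?h a then f n else 0)"
    using gf npulls_hist_pos[OF _ a] by (intro sum_pulls_le) (auto simp: take_hist nth_hist_act)
  finally show ?thesis by simp
qed

lemma est_hist:
  assumes "k \<le> T" "npulls (hist R G k) a = n"
  shows "ape_est p c R (hist R G k) a = c / real n powr (1 / q) * psum p c n a R (hist R G T)"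
  using ape_est_take[of k "hist R G T" a n p c R] assms by (simp add: take_hist q_props)

text \<open>A bad pull after n earlier ones forces the sum frozen at n above (r + \<delta>) n^(1/q)
  / c, while its compensator is only r n^(1/q) / c + Bc; the difference is the exponent.\<close>

lemma nn_integral_overestimated_pulls:
  assumes a: "a < K"
  shows "(\<integral>\<^sup>+\<omega>. (\<Sum>k<T. if act k \<omega> = a \<and> K \<le> k then
        (if mean_reward D a + \<delta> < ape_est p c (fst \<omega>) (hist (fst \<omega>) (snd \<omega>) k) a then 1 else 0) else 0) \<partial>\<Omega>)
    \<le> (\<Sum>n=1..T. ennreal (exp (Bc - \<delta> / c * real n powr (1 / q))))"
proof -
  let ?r = "mean_reward D a"
  let ?N = "\<lambda>\<omega>. npulls (hist (fst \<omega>) (snd \<omega>) T) a"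
  let ?S = "\<lambda>n \<omega>. psum p c n a (fst \<omega>) (hist (fst \<omega>) (snd \<omega>) T)"
  let ?P = "\<lambda>n \<omega>. (?r + \<delta>) * real n powr (1 / q) / c \<le> 1 * ?S n \<omega>"
  have "(\<integral>\<^sup>+\<omega>. (\<Sum>k<T. if act k \<omega> = a \<and> K \<le> k then
        (if ?r + \<delta> < ape_est p c (fst \<omega>) (hist (fst \<omega>) (snd \<omega>) k) a then 1 else 0) else 0) \<partial>\<Omega>)
      \<le> (\<integral>\<^sup>+\<omega>. (\<Sum>n=1..T. if n \<le> ?N \<omega> then (if ?P n \<omega> then 1 else 0) else 0) \<partial>\<Omega>)"
  proof (intro nn_integral_mono sum_act_le a)
    fix \<omega> k assume k: "k < T" "K \<le> k"
    define n where "n = npulls (hist (fst \<omega>) (snd \<omega>) k) a"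
    have n: "1 \<le> n" unfolding n_def by (rule npulls_hist_pos[OF k(2) a])
    have e: "ape_est p c (fst \<omega>) (hist (fst \<omega>) (snd \<omega>) k) a = c / real n powr (1 / q) * ?S n \<omega>"
      using k by (intro est_hist) (auto simp: n_def)
    have "u < c / real n powr (1 / q) * s \<Longrightarrow> u * real n powr (1 / q) / c \<le> 1 * s" for u s
      using n c by (simp add: field_simps)
    then show "(if ?r + \<delta> < ape_est p c (fst \<omega>) (hist (fst \<omega>) (snd \<omega>) k) a then 1 else 0 :: ennreal)
        \<le> (if ?P (npulls (hist (fst \<omega>) (snd \<omega>) k) a) \<omega> then 1 else 0)"
      unfolding n_def[symmetric] e by (simp del: mult_1 mult_1_left)
  qed
  also have "\<dots> = (\<integral>\<^sup>+\<omega>. (\<Sum>n=1..T. if n \<le> ?N \<omega> \<and> ?P n \<omega> then 1 else 0) \<partial>\<Omega>)"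
    by (intro nn_integral_cong sum.cong) auto
  also have "\<dots> = (\<Sum>n=1..T. \<integral>\<^sup>+\<omega>. (if n \<le> ?N \<omega> \<and> ?P n \<omega> then 1 else 0) \<partial>\<Omega>)"
    by (rule nn_integral_sum) measurable
  also have "\<dots> \<le> (\<Sum>n=1..T. ennreal (exp (Bc - \<delta> / c * real n powr (1 / q))))"
  proof (rule sum_mono)
    fix n assume n: "n \<in> {1..T}"
    have "(\<integral>\<^sup>+\<omega>. (if n \<le> ?N \<omega> \<and> ?P n \<omega> then 1 else 0) \<partial>\<Omega>) = emeasure \<Omega> {\<omega>\<in>space \<Omega>. n \<le> ?N \<omega> \<and> ?P n \<omega>}"
      by (rule nn_integral_if_eq_emeasure) measurable
    also have "\<dots> \<le> ennreal (exp (1 * ?r * real n powr (1 - 1 / p) / c + Bc - (?r + \<delta>) * real n powr (1 / q) / c))"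
      using n by (intro emeasure_psum_ge a) auto
    also have "1 * ?r * real n powr (1 - 1 / p) / c + Bc - (?r + \<delta>) * real n powr (1 / q) / c
        = Bc - \<delta> / c * real n powr (1 / q)"
      using c by (simp add: q_props field_simps)
    finally show "(\<integral>\<^sup>+\<omega>. (if n \<le> ?N \<omega> \<and> ?P n \<omega> then 1 else 0) \<partial>\<Omega>)
        \<le> ennreal (exp (Bc - \<delta> / c * real n powr (1 / q)))" .
  qed
  finally show ?thesis .
qed

lemma nn_integral_low_index_pulls:
  assumes a: "a < K" "a \<noteq> astar" and \<delta>: "0 \<le> \<delta>"
  shows "(\<integral>\<^sup>+\<omega>. (\<Sum>k<T. if act k \<omega> = a \<and> K \<le> k then
        (if ape_index p c (fst \<omega>) (snd \<omega>) (Suc k) (hist (fst \<omega>) (snd \<omega>) k) a \<le> mean_reward D astar - 2 * \<delta>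
          then 1 else 0) else 0) \<partial>\<Omega>)
    \<le> (\<Sum>n=1..T. ennreal (2 * F (- (\<delta> / c * real n powr (1 / q)))
        + (3 + max CF 0) * exp (Bc - \<delta> / c * real n powr (1 / q))))"
proof -
  let ?r = "mean_reward D astar"
  let ?y = "?r - 2 * \<delta>"
  let ?N = "\<lambda>\<omega>. npulls (hist (fst \<omega>) (snd \<omega>) T) astar"
  let ?S = "\<lambda>n \<omega>. psum p c n astar (fst \<omega>) (hist (fst \<omega>) (snd \<omega>) T)"
  let ?Z = "\<lambda>n \<omega>. real n powr (1 / q) * ?y / c - ?S n \<omega>"
  let ?I = "\<lambda>k \<omega>. ape_index p c (fst \<omega>) (snd \<omega>) (Suc k) (hist (fst \<omega>) (snd \<omega>) k) a"
  have "(\<integral>\<^sup>+\<omega>. (\<Sum>k<T. if act k \<omega> = a \<and> K \<le> k then (if ?I k \<omega> \<le> ?y then 1 else 0) else 0) \<partial>\<Omega>)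
      = (\<Sum>k<T. \<integral>\<^sup>+\<omega>. (if act k \<omega> = a \<and> K \<le> k then (if ?I k \<omega> \<le> ?y then 1 else 0) else 0) \<partial>\<Omega>)"
    by (rule nn_integral_sum) measurable
  also have "\<dots> \<le> (\<Sum>k<T. \<integral>\<^sup>+\<omega>. (if act k \<omega> = astar \<and> K \<le> k then ennreal (odds (thr k ?y \<omega>)) else 0) \<partial>\<Omega>)"
  proof (rule sum_mono)
    fix k
    show "(\<integral>\<^sup>+\<omega>. (if act k \<omega> = a \<and> K \<le> k then (if ?I k \<omega> \<le> ?y then 1 else 0) else 0) \<partial>\<Omega>)
        \<le> (\<integral>\<^sup>+\<omega>. (if act k \<omega> = astar \<and> K \<le> k then ennreal (odds (thr k ?y \<omega>)) else 0) \<partial>\<Omega>)"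
    proof (cases "K \<le> k")
      case True
      have "(\<integral>\<^sup>+\<omega>. (if act k \<omega> = a \<and> K \<le> k then (if ?I k \<omega> \<le> ?y then 1 else 0) else 0) \<partial>\<Omega>)
          = (\<integral>\<^sup>+\<omega>. (if act k \<omega> = a \<and> ?I k \<omega> \<le> ?y then 1 else 0) \<partial>\<Omega>)"
        using True by (intro nn_integral_cong) auto
      also have "\<dots> \<le> (\<integral>\<^sup>+\<omega>. ennreal (odds (thr k ?y \<omega>)) * (if act k \<omega> = astar then 1 else 0) \<partial>\<Omega>)"
        by (rule nn_integral_low_index_le[OF a True])
      also have "\<dots> = (\<integral>\<^sup>+\<omega>. (if act k \<omega> = astar \<and> K \<le> k then ennreal (odds (thr k ?y \<omega>)) else 0) \<partial>\<Omega>)"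
        using True by (intro nn_integral_cong) auto
      finally show ?thesis .
    qed simp
  qed
  also have "\<dots> = (\<integral>\<^sup>+\<omega>. (\<Sum>k<T. if act k \<omega> = astar \<and> K \<le> k then ennreal (odds (thr k ?y \<omega>)) else 0) \<partial>\<Omega>)"
    by (rule nn_integral_sum[symmetric]) measurable
  also have "\<dots> \<le> (\<integral>\<^sup>+\<omega>. (\<Sum>n=1..T. if n \<le> ?N \<omega> then ennreal (odds (?Z n \<omega>)) else 0) \<partial>\<Omega>)"
  proof (intro nn_integral_mono sum_act_le astar)
    fix \<omega> k assume k: "k < T" "K \<le> k"
    define n where "n = npulls (hist (fst \<omega>) (snd \<omega>) k) astar"
    have n: "1 \<le> n" unfolding n_def by (rule npulls_hist_pos[OF k(2) astar])
    have e: "ape_est p c (fst \<omega>) (hist (fst \<omega>) (snd \<omega>) k) astar = c / real n powr (1 / q) * ?S n \<omega>"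
      using k by (intro est_hist) (auto simp: n_def)
    have "thr k ?y \<omega> = ?Z n \<omega>"
      unfolding thr_def e using n c by (simp add: ape_beta_def q_props n_def[symmetric] field_simps)
    then show "ennreal (odds (thr k ?y \<omega>)) \<le> ennreal (odds (?Z (npulls (hist (fst \<omega>) (snd \<omega>) k) astar) \<omega>))"
      unfolding n_def[symmetric] by simp
  qed
  also have "\<dots> = (\<Sum>n=1..T. \<integral>\<^sup>+\<omega>. (if n \<le> ?N \<omega> then ennreal (odds (?Z n \<omega>)) else 0) \<partial>\<Omega>)"
    by (rule nn_integral_sum) measurable
  also have "\<dots> \<le> (\<Sum>n=1..T. ennreal (2 * F (- (\<delta> / c * real n powr (1 / q)))
        + (3 + max CF 0) * exp (Bc - \<delta> / c * real n powr (1 / q))))"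
  proof (rule sum_mono)
    fix n assume n: "n \<in> {1..T}"
    let ?d = "\<delta> / c * real n powr (1 / q)"
    let ?E = "{\<omega>\<in>space \<Omega>. n \<le> ?N \<omega>}"
    \<comment> \<open>The margin 2 \<delta> gives a tail constant exp (Bc - 2 d). Splitting the odds
      at - d costs a factor exp d, so exp (Bc - d) survives next to 2 F(- d).\<close>
    let ?B = "exp (Bc - 2 * ?d)"
    have d: "0 \<le> ?d" using \<delta> c by simp
    have "(\<integral>\<^sup>+\<omega>. (if n \<le> ?N \<omega> then ennreal (odds (?Z n \<omega>)) else 0) \<partial>\<Omega>)
        = (\<integral>\<^sup>+\<omega>. ennreal (odds (?Z n \<omega>)) * indicator ?E \<omega> \<partial>\<Omega>)"
      by (intro nn_integral_cong) auto
    also have "\<dots> \<le> ennreal (2 * F (- ?d) + ?B * exp ?d + (2 + max CF 0) * ?B)"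
    proof (rule nn_integral_odds_le[OF prob_space_\<Omega> _ _ _ d])
      show "?E \<in> sets \<Omega>" by measurable
      show "?Z n \<in> borel_measurable \<Omega>" by measurable
      show "0 \<le> ?B" by simp
      fix x
      have "{\<omega>\<in>?E. x \<le> ?Z n \<omega>} = {\<omega>\<in>space \<Omega>. n \<le> ?N \<omega> \<and> x - real n powr (1 / q) * ?y / c \<le> - 1 * ?S n \<omega>}"
        by auto
      also have "emeasure \<Omega> \<dots> \<le> ennreal (exp (- 1 * ?r * real n powr (1 - 1 / p) / c + Bc - (x - real n powr (1 / q) * ?y / c)))"
        using n by (intro emeasure_psum_ge astar) auto
      also have "- 1 * ?r * real n powr (1 - 1 / p) / c + Bc - (x - real n powr (1 / q) * ?y / c) = (Bc - 2 * ?d) + - x"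
        using c by (simp add: q_props field_simps)
      finally show "emeasure \<Omega> {\<omega>\<in>?E. x \<le> ?Z n \<omega>} \<le> ennreal (?B * exp (- x))"
        by (simp only: exp_add)
    qed
    also have "\<dots> \<le> ennreal (2 * F (- ?d) + (3 + max CF 0) * exp (Bc - ?d))"
    proof (rule ennreal_leI)
      have "?B * exp ?d = exp (Bc - ?d)" by (simp flip: exp_add)
      moreover have "(2 + max CF 0) * ?B \<le> (2 + max CF 0) * exp (Bc - ?d)"
        using d by (intro mult_left_mono) auto
      ultimately show "2 * F (- ?d) + ?B * exp ?d + (2 + max CF 0) * ?B \<le> 2 * F (- ?d) + (3 + max CF 0) * exp (Bc - ?d)"
        by (simp add: algebra_simps)
    qed
    finally show "(\<integral>\<^sup>+\<omega>. (if n \<le> ?N \<omega> then ennreal (odds (?Z n \<omega>)) else 0) \<partial>\<Omega>) \<le> \<dots>" .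
  qed
  finally show ?thesis .
qed

text \<open>L is the count from which a bonus above \<delta> needs a perturbation above the 1 - y
  quantile. Pulls with a smaller count number at most L, and each of the T rounds has such a
  perturbation with probability y.\<close>

lemma nn_integral_large_perturbation_pulls:
  assumes a: "a < K" and \<delta>: "0 < \<delta>" and y: "0 < y" "y < 1"
  shows "(\<integral>\<^sup>+\<omega>. (\<Sum>k<T. if act k \<omega> = a \<and> K \<le> k then
        (if \<delta> < ape_beta p c (hist (fst \<omega>) (snd \<omega>) k) a * snd \<omega> (Suc k, a) then 1 else 0) else 0) \<partial>\<Omega>)
    \<le> ennreal ((c / \<delta>) powr q * pospart (Finv F (1 - y)) powr q + real T * y)"
proof -
  define g0 where "g0 = Finv F (1 - y)"
  define L where "L = (c / \<delta> * pospart g0) powr q"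
  let ?I = "\<lambda>k \<omega>. if \<delta> < ape_beta p c (hist (fst \<omega>) (snd \<omega>) k) a * snd \<omega> (Suc k, a) then 1 else 0 :: ennreal"
  let ?J = "\<lambda>k \<omega>. if g0 < snd \<omega> (Suc k, a) then 1 else 0 :: ennreal"
  have int_J: "(\<integral>\<^sup>+\<omega>. ?J k \<omega> \<partial>\<Omega>) = ennreal y" for k
  proof -
    have "(\<integral>\<^sup>+\<omega>. ?J k \<omega> \<partial>\<Omega>) = emeasure \<Omega> {\<omega>\<in>space \<Omega>. g0 < snd \<omega> (Suc k, a)}"
      by (rule nn_integral_if_eq_emeasure) measurable
    then show ?thesis using F_Finv[of "1 - y"] y by (simp add: emeasure_perturbation_gt g0_def)
  qed
  have "(\<Sum>k<T. if act k \<omega> = a \<and> K \<le> k then ?I k \<omega> else 0) \<le> ennreal L + (\<Sum>k<T. ?J k \<omega>)" for \<omega>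
  proof -
    let ?n = "\<lambda>k. npulls (hist (fst \<omega>) (snd \<omega>) k) a"
    have "(\<Sum>k<T. if act k \<omega> = a \<and> K \<le> k then ?I k \<omega> else 0)
        \<le> (\<Sum>k<T. (if act k \<omega> = a \<and> K \<le> k then (if real (?n k) < L then 1 else 0) else 0) + ?J k \<omega>)"
    proof (rule sum_mono)
      fix k
      have "g0 < snd \<omega> (Suc k, a)"
        if k: "K \<le> k" and I: "\<delta> < ape_beta p c (hist (fst \<omega>) (snd \<omega>) k) a * snd \<omega> (Suc k, a)"
          and L: "L \<le> real (?n k)"
      proof -
        have n: "1 \<le> ?n k" by (rule npulls_hist_pos[OF k a])
        have "c / \<delta> * pospart g0 \<le> real (?n k) powr (1 / q)"
          using L c \<delta> q_props unfolding L_def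
          by (intro powr_le_of_inverse_powr_le) (auto simp: pospart_def)
        then have "pospart g0 \<le> \<delta> * real (?n k) powr (1 / q) / c" using c \<delta> by (simp add: field_simps)
        also have "\<dots> < snd \<omega> (Suc k, a)"
          using I n c by (simp add: ape_beta_def q_props field_simps)
        finally show ?thesis by (simp add: pospart_def)
      qed
      then show "(if act k \<omega> = a \<and> K \<le> k then ?I k \<omega> else 0)
          \<le> (if act k \<omega> = a \<and> K \<le> k then (if real (?n k) < L then 1 else 0) else 0) + ?J k \<omega>"
        by (auto simp: not_less)
    qed
    also have "\<dots> = (\<Sum>k<T. if act k \<omega> = a \<and> K \<le> k then (if real (?n k) < L then 1 else 0) else 0) + (\<Sum>k<T. ?J k \<omega>)"
      by (rule sum.distrib)
    also have "\<dots> \<le> (\<Sum>n=1..T. if n \<le> ?n T then (if real n < L then 1 else 0) else 0) + (\<Sum>k<T. ?J k \<omega>)"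
      by (intro add_right_mono sum_act_le a) auto
    also have "\<dots> \<le> (\<Sum>n=1..T. ennreal (if real n < L then 1 else 0)) + (\<Sum>k<T. ?J k \<omega>)"
      by (intro add_right_mono sum_mono) auto
    also have "(\<Sum>n=1..T. ennreal (if real n < L then 1 else 0)) \<le> ennreal L"
      using sum_less_bound[of L T] by (subst sum_ennreal) (auto simp: L_def intro!: ennreal_leI)
    finally show ?thesis by (simp add: add_right_mono)
  qed
  then have "(\<integral>\<^sup>+\<omega>. (\<Sum>k<T. if act k \<omega> = a \<and> K \<le> k then ?I k \<omega> else 0) \<partial>\<Omega>)
      \<le> (\<integral>\<^sup>+\<omega>. ennreal L + (\<Sum>k<T. ?J k \<omega>) \<partial>\<Omega>)"
    by (intro nn_integral_mono)
  also have "\<dots> = ennreal L + (\<Sum>k<T. \<integral>\<^sup>+\<omega>. ?J k \<omega> \<partial>\<Omega>)"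
    by (simp add: nn_integral_add nn_integral_sum \<Omega>.emeasure_space_1)
  also have "\<dots> = ennreal (L + real T * y)"
    unfolding int_J using y by (simp add: L_def ennreal_mult' ennreal_of_nat_eq_real_of_nat)
  also have "L = (c / \<delta>) powr q * pospart g0 powr q"
    unfolding L_def by (rule powr_mult)
  finally show ?thesis by (simp add: g0_def)
qed

end

section \<open>Regret bound\<close>

context bandit
begin

lemma npulls_hist_eq_sum: "npulls (hist (fst \<omega>) (snd \<omega>) T) a = (\<Sum>k<T. if act k \<omega> = a then 1 else 0)"
  unfolding npulls_eq_sum by (intro sum.cong) (auto simp: nth_hist_act)

lemma act_initial: "k < K \<Longrightarrow> act k \<omega> = k"
  by (simp add: act_def ape_choose_def)

text \<open>The 1 is the initial pull. If neither the estimate nor the bonus is too large, the index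
  is at most r a + 2 \<delta> = r astar - \<delta>; this is written with
  \<open>2 * (\<delta> / 2)\<close> to fit \<open>nn_integral_low_index_pulls\<close>.\<close>

lemma npulls_le_decomposition:
  assumes a: "a < K" and \<delta>: "mean_reward D astar = mean_reward D a + 3 * \<delta>"
  shows "ennreal (real (npulls (hist (fst \<omega>) (snd \<omega>) T) a))
    \<le> 1 + (\<Sum>k<T. if act k \<omega> = a \<and> K \<le> k then
          (if mean_reward D a + \<delta> < ape_est p c (fst \<omega>) (hist (fst \<omega>) (snd \<omega>) k) a then 1 else 0) else 0)
      + (\<Sum>k<T. if act k \<omega> = a \<and> K \<le> k then
          (if \<delta> < ape_beta p c (hist (fst \<omega>) (snd \<omega>) k) a * snd \<omega> (Suc k, a) then 1 else 0) else 0)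
      + (\<Sum>k<T. if act k \<omega> = a \<and> K \<le> k then
          (if ape_index p c (fst \<omega>) (snd \<omega>) (Suc k) (hist (fst \<omega>) (snd \<omega>) k) a
              \<le> mean_reward D astar - 2 * (\<delta> / 2) then 1 else 0) else 0)"
    (is "_ \<le> 1 + ?A + ?B + ?C")
proof -
  have "ennreal (real (npulls (hist (fst \<omega>) (snd \<omega>) T) a)) = (\<Sum>k<T. if act k \<omega> = a then 1 else 0)"
    unfolding npulls_hist_eq_sum of_nat_sum
    by (subst sum_ennreal[symmetric], simp, intro sum.cong) auto
  also have "\<dots> \<le> (\<Sum>k<T. (if k = a then 1 else 0)) + ?A + ?B + ?C"
    unfolding sum.distrib[symmetric]
  proof (rule sum_mono)
    fix k
    show "(if act k \<omega> = a then 1 else 0 :: ennreal) \<le> (if k = a then 1 else 0)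
      + (if act k \<omega> = a \<and> K \<le> k then
          (if mean_reward D a + \<delta> < ape_est p c (fst \<omega>) (hist (fst \<omega>) (snd \<omega>) k) a then 1 else 0) else 0)
      + (if act k \<omega> = a \<and> K \<le> k then
          (if \<delta> < ape_beta p c (hist (fst \<omega>) (snd \<omega>) k) a * snd \<omega> (Suc k, a) then 1 else 0) else 0)
      + (if act k \<omega> = a \<and> K \<le> k then
          (if ape_index p c (fst \<omega>) (snd \<omega>) (Suc k) (hist (fst \<omega>) (snd \<omega>) k) a
              \<le> mean_reward D astar - 2 * (\<delta> / 2) then 1 else 0) else 0)"
      using act_initial[of k \<omega>] \<delta> unfolding ape_index_def by (cases "K \<le> k") auto
  qed
  also have "\<dots> \<le> 1 + ?A + ?B + ?C"
    by (intro add_right_mono) simp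
  finally show ?thesis .
qed

text \<open>The overestimates contribute E and the low indices (3 + max CF 0) E, which makes 4 + max
  CF 0; in the same way T y from the large perturbations and 2 T y from the low indices make 3 T
  y.\<close>

lemma nn_integral_npulls_le:
  assumes a: "a < K" "a \<noteq> astar"
    and C: "\<And>\<alpha>. 0 < \<alpha> \<Longrightarrow> (\<Sum>n=1..T. exp (- (\<alpha> * real n powr (1 / q)))) \<le> C / \<alpha> powr q"
    and y: "0 < y" "y < 1"
  defines "\<Delta> \<equiv> mean_reward D astar - mean_reward D a"
  shows "(\<integral>\<^sup>+\<omega>. ennreal (real (npulls (hist (fst \<omega>) (snd \<omega>) T) a)) \<partial>\<Omega>)
    \<le> ennreal (1 + (4 + max CF 0) * exp Bc * (C * (6 * c / \<Delta>) powr q)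
        + (3 * c / \<Delta>) powr q * pospart (Finv F (1 - y)) powr q
        + (6 * c / \<Delta>) powr q * pospart (- Finv F y) powr q + 3 * (real T * y))"
proof -
  define \<delta> where "\<delta> = \<Delta> / 3"
  have \<delta>: "0 < \<delta>" "mean_reward D astar = mean_reward D a + 3 * \<delta>"
    using opt[OF a] by (simp_all add: \<delta>_def \<Delta>_def field_simps)
  have \<Delta>: "0 < \<Delta>" using \<delta> by (simp add: \<delta>_def)
  define S where "S d = (\<Sum>n=1..T. exp (Bc - d / c * real n powr (1 / q)))" for d
  define E where "E = exp Bc * (C * (6 * c / \<Delta>) powr q)"
  define L where "L = (6 * c / \<Delta> * pospart (- Finv F y)) powr q"
  have S: "S (\<delta> / 2) \<le> E"
  proof -
    have "S (\<delta> / 2) = exp Bc * (\<Sum>n=1..T. exp (- (\<delta> / 2 / c * real n powr (1 / q))))"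
      unfolding S_def sum_distrib_left by (intro sum.cong) (simp_all flip: exp_add)
    also have "\<dots> \<le> exp Bc * (C / (\<delta> / 2 / c) powr q)"
      using \<delta> c by (intro mult_left_mono C) auto
    also have "C / (\<delta> / 2 / c) powr q = C * (6 * c / \<Delta>) powr q"
      using \<Delta> c by (simp add: \<delta>_def powr_divide powr_mult)
    finally show ?thesis by (simp add: E_def)
  qed
  have "S \<delta> \<le> S (\<delta> / 2)"
    unfolding S_def using \<delta> c by (intro sum_mono) (auto intro!: divide_left_mono)
  with S have S': "S \<delta> \<le> E" by simp
  have low: "(\<Sum>n=1..T. 2 * F (- (\<delta> / 2 / c * real n powr (1 / q))) + (3 + max CF 0) * exp (Bc - \<delta> / 2 / c * real n powr (1 / q)))
      \<le> L + 2 * (real T * y) + (3 + max CF 0) * E"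
  proof -
    \<comment> \<open>From count L on, - d lies below the y-quantile, so F(- d) <= y; for smaller n
      the bound 2 F 0 <= 1 is enough.\<close>
    have "(\<Sum>n=1..T. 2 * F (- (\<delta> / 2 / c * real n powr (1 / q)))) \<le> (\<Sum>n=1..T. (if real n < L then 1 else 0) + 2 * y)"
    proof (rule sum_mono)
      fix n
      let ?d = "\<delta> / 2 / c * real n powr (1 / q)"
      show "2 * F (- ?d) \<le> (if real n < L then 1 else 0) + 2 * y"
      proof (cases "real n < L")
        case True
        have "F (- ?d) \<le> F 0" using \<delta> c by (intro F_mono) simp
        then show ?thesis using F_0 y True by simp
      next
        case False
        then have "6 * c / \<Delta> * pospart (- Finv F y) \<le> real n powr (1 / q)"
          using c \<Delta> q_props unfolding L_def
          by (intro powr_le_of_inverse_powr_le) (auto simp: pospart_def)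
        then have "pospart (- Finv F y) \<le> ?d" using c \<Delta> by (simp add: \<delta>_def field_simps)
        then have "F (- ?d) \<le> F (Finv F y)" by (intro F_mono) (simp add: pospart_def)
        then show ?thesis using F_Finv[OF y] False by simp
      qed
    qed
    also have "\<dots> = (\<Sum>n=1..T. if real n < L then 1 else 0) + 2 * (real T * y)"
      by (simp add: sum.distrib)
    also have "\<dots> \<le> L + 2 * (real T * y)"
      by (intro add_right_mono sum_less_bound) (simp add: L_def)
    finally have "(\<Sum>n=1..T. 2 * F (- (\<delta> / 2 / c * real n powr (1 / q)))) \<le> L + 2 * (real T * y)" .
    moreover have "(3 + max CF 0) * S (\<delta> / 2) \<le> (3 + max CF 0) * E"
      by (intro mult_left_mono S) auto
    ultimately show ?thesis
      by (simp add: sum.distrib S_def sum_distrib_left)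
  qed
  let ?A = "\<lambda>\<omega>. \<Sum>k<T. if act k \<omega> = a \<and> K \<le> k then
          (if mean_reward D a + \<delta> < ape_est p c (fst \<omega>) (hist (fst \<omega>) (snd \<omega>) k) a then 1 else 0) else 0 :: ennreal"
  let ?B = "\<lambda>\<omega>. \<Sum>k<T. if act k \<omega> = a \<and> K \<le> k then
          (if \<delta> < ape_beta p c (hist (fst \<omega>) (snd \<omega>) k) a * snd \<omega> (Suc k, a) then 1 else 0) else 0 :: ennreal"
  let ?C = "\<lambda>\<omega>. \<Sum>k<T. if act k \<omega> = a \<and> K \<le> k then
          (if ape_index p c (fst \<omega>) (snd \<omega>) (Suc k) (hist (fst \<omega>) (snd \<omega>) k) a
              \<le> mean_reward D astar - 2 * (\<delta> / 2) then 1 else 0) else 0 :: ennreal"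
  have A: "integral\<^sup>N \<Omega> ?A \<le> ennreal E"
  proof -
    have "integral\<^sup>N \<Omega> ?A \<le> ennreal (S \<delta>)"
      using nn_integral_overestimated_pulls[OF a(1), where T = T and \<delta> = \<delta>] by (simp add: S_def sum_ennreal)
    then show ?thesis using S' by (meson ennreal_leI order_trans)
  qed
  have B: "integral\<^sup>N \<Omega> ?B \<le> ennreal ((3 * c / \<Delta>) powr q * pospart (Finv F (1 - y)) powr q + real T * y)"
    using nn_integral_large_perturbation_pulls[OF a(1) \<delta>(1) y, where T = T] by (simp add: \<delta>_def mult.commute)
  have C: "integral\<^sup>N \<Omega> ?C \<le> ennreal (L + 2 * (real T * y) + (3 + max CF 0) * E)"
  proof -
    have "integral\<^sup>N \<Omega> ?C \<le> (\<Sum>n=1..T. ennreal (2 * F (- (\<delta> / 2 / c * real n powr (1 / q))) + (3 + max CF 0) * exp (Bc - \<delta> / 2 / c * real n powr (1 / q))))"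
      using \<delta> by (intro nn_integral_low_index_pulls a) auto
    also have "\<dots> = ennreal (\<Sum>n=1..T. 2 * F (- (\<delta> / 2 / c * real n powr (1 / q))) + (3 + max CF 0) * exp (Bc - \<delta> / 2 / c * real n powr (1 / q)))"
      using F_nonneg by (intro sum_ennreal) (auto intro!: add_nonneg_nonneg)
    also have "\<dots> \<le> ennreal (L + 2 * (real T * y) + (3 + max CF 0) * E)"
      by (intro ennreal_leI low)
    finally show ?thesis .
  qed
  have E: "0 \<le> E"
    by (rule order_trans[OF _ S']) (simp add: S_def sum_nonneg)
  have "(\<integral>\<^sup>+\<omega>. ennreal (real (npulls (hist (fst \<omega>) (snd \<omega>) T) a)) \<partial>\<Omega>)
      \<le> (\<integral>\<^sup>+\<omega>. 1 + ?A \<omega> + ?B \<omega> + ?C \<omega> \<partial>\<Omega>)"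
    by (intro nn_integral_mono npulls_le_decomposition a \<delta>)
  also have "\<dots> = 1 + integral\<^sup>N \<Omega> ?A + integral\<^sup>N \<Omega> ?B + integral\<^sup>N \<Omega> ?C"
  proof -
    have [measurable]: "?A \<in> borel_measurable \<Omega>" "?B \<in> borel_measurable \<Omega>" "?C \<in> borel_measurable \<Omega>"
      by measurable
    show ?thesis by (simp add: nn_integral_add \<Omega>.emeasure_space_1)
  qed
  also have "\<dots> \<le> ennreal 1 + ennreal E + ennreal ((3 * c / \<Delta>) powr q * pospart (Finv F (1 - y)) powr q + real T * y)
      + ennreal (L + 2 * (real T * y) + (3 + max CF 0) * E)"
    using A B C by (intro add_mono) auto
  also have "\<dots> = ennreal (1 + E + ((3 * c / \<Delta>) powr q * pospart (Finv F (1 - y)) powr q + real T * y)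
      + (L + 2 * (real T * y) + (3 + max CF 0) * E))"
  proof -
    have plus: "ennreal 1 + ennreal E + ennreal u + ennreal v = ennreal (1 + E + u + v)"
      if "0 \<le> u" "0 \<le> v" for u v using that E by simp
    show ?thesis using E y by (intro plus) (auto simp: L_def)
  qed
  also have "L = (6 * c / \<Delta>) powr q * pospart (- Finv F y) powr q"
    unfolding L_def by (rule powr_mult)
  finally show ?thesis by (simp add: E_def algebra_simps)
qed

lemma ape_regret_eq:
  "ape_regret K p c (mean_reward D) astar T R G
    = (\<Sum>a\<in>{a. a < K \<and> a \<noteq> astar}. (mean_reward D astar - mean_reward D a) * real (npulls (hist R G T) a))"
proof -
  let ?\<Delta> = "\<lambda>a. mean_reward D astar - mean_reward D a"
  let ?h = "hist R G T"
  have "ape_regret K p c (mean_reward D) astar T R G = (\<Sum>k<T. ?\<Delta> (?h ! k))"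
    by (simp add: ape_regret_def Let_def)
  also have "\<dots> = (\<Sum>k<T. \<Sum>a<K. if ?h ! k = a then ?\<Delta> a else 0)"
    by (intro sum.cong) (auto simp: nth_hist_less)
  also have "\<dots> = (\<Sum>a<K. \<Sum>k<T. if ?h ! k = a then ?\<Delta> a else 0)"
    by (rule sum.swap)
  also have "\<dots> = (\<Sum>a<K. ?\<Delta> a * real (npulls ?h a))"
    unfolding npulls_eq_sum by (auto simp: sum_distrib_left intro!: sum.cong)
  also have "\<dots> = (\<Sum>a\<in>{a. a < K \<and> a \<noteq> astar}. ?\<Delta> a * real (npulls ?h a))"
    by (intro sum.mono_neutral_right) auto
  finally show ?thesis .
qed

text \<open>Collects what is left after multiplying by \<Delta>: 3 c^q from the 3 T y rounds, the
  rest from the exponential tails. Here C is the constant of the stretched exponential sum.\<close>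

definition Ccst :: "real \<Rightarrow> real" where
  "Ccst C = 3 * c powr q + (4 + max CF 0) * exp Bc * (C * (6 * c) powr q)"

text \<open>Since \<Delta>^q = \<Delta> W with W = \<Delta>^(1/(p-1)), the identity \<Delta> (u /
  \<Delta>)^q = u^q / W converts each pull count into the shape of
  \<open>bound_term\<close>.\<close>

lemma nn_integral_arm_regret_le:
  assumes a: "a < K" "a \<noteq> astar" and C: "0 < C"
    and sum_le: "\<And>\<alpha> N. 0 < \<alpha> \<Longrightarrow> (\<Sum>n=1..N. exp (- (\<alpha> * real n powr (1 / q)))) \<le> C / \<alpha> powr q"
  defines "\<Delta> \<equiv> mean_reward D astar - mean_reward D a"
  shows "(\<integral>\<^sup>+\<omega>. ennreal (\<Delta> * real (npulls (hist (fst \<omega>) (snd \<omega>) T) a)) \<partial>\<Omega>)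
    \<le> ennreal (bound_term c p F T (Ccst C) \<Delta>)"
proof -
  have \<Delta>: "0 < \<Delta>" using opt[OF a] by (simp add: \<Delta>_def)
  define W where "W = \<Delta> powr (1 / (p - 1))"
  have W: "0 < W" using \<Delta> by (simp add: W_def)
  have \<Delta>q: "\<Delta> powr q = \<Delta> * W"
    using \<Delta> powr_add[of \<Delta> 1 "1 / (p - 1)"] q_props(3)[symmetric] by (simp add: W_def)
  have div: "\<Delta> * (u / \<Delta>) powr q = u powr q / W" if "0 \<le> u" for u
    using \<Delta> W that by (simp add: powr_divide \<Delta>q)
  define y where "y = c powr q / (real T * \<Delta> powr q)"
  have bt: "bound_term c p F T (Ccst C) \<Delta> = Ccst C / W
      + (6 * c) powr q / W * (if 0 < y \<and> y < 1 then pospart (- Finv F y) powr q else 0)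
      + (3 * c) powr q / W * (if 0 < 1 - y \<and> 1 - y < 1 then pospart (Finv F (1 - y)) powr q else 0) + \<Delta>"
    by (simp add: bound_term_def Let_def q_def[symmetric] y_def W_def)
  show ?thesis
  proof (cases "0 < y \<and> y < 1")
    case True
    then have y: "0 < y" "y < 1" by auto
    then have "0 < T" by (auto simp: y_def intro!: gr0I)
    then have "real T * y = (c / \<Delta>) powr q"
      using c \<Delta> by (simp add: y_def powr_divide)
    then have Ty: "\<Delta> * (real T * y) = c powr q / W" using div[of c] c by simp
    let ?X = "1 + (4 + max CF 0) * exp Bc * (C * (6 * c / \<Delta>) powr q)
        + (3 * c / \<Delta>) powr q * pospart (Finv F (1 - y)) powr q
        + (6 * c / \<Delta>) powr q * pospart (- Finv F y) powr q + 3 * (real T * y)"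
    have "(\<integral>\<^sup>+\<omega>. ennreal (\<Delta> * real (npulls (hist (fst \<omega>) (snd \<omega>) T) a)) \<partial>\<Omega>)
        = ennreal \<Delta> * (\<integral>\<^sup>+\<omega>. ennreal (real (npulls (hist (fst \<omega>) (snd \<omega>) T) a)) \<partial>\<Omega>)"
      using \<Delta> by (subst nn_integral_cmult[symmetric]) (auto simp: ennreal_mult', measurable)
    also have "\<dots> \<le> ennreal \<Delta> * ennreal ?X"
      unfolding \<Delta>_def by (intro mult_left_mono nn_integral_npulls_le a y sum_le) auto
    also have "\<dots> = ennreal (\<Delta> * ?X)" using \<Delta> by (simp add: ennreal_mult')
    also have "\<Delta> * ?X = \<Delta> + (4 + max CF 0) * exp Bc * C * (\<Delta> * (6 * c / \<Delta>) powr q)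
        + (\<Delta> * (3 * c / \<Delta>) powr q) * pospart (Finv F (1 - y)) powr q
        + (\<Delta> * (6 * c / \<Delta>) powr q) * pospart (- Finv F y) powr q + 3 * (\<Delta> * (real T * y))"
      by (simp only: distrib_left mult_1_right mult.assoc mult.left_commute)
    also have "\<dots> = bound_term c p F T (Ccst C) \<Delta>"
      unfolding bt Ty using True c by (subst (1 2 3) div) (simp_all add: Ccst_def add_divide_distrib)
    finally show ?thesis .
  next
    case False
    \<comment> \<open>Either y >= 1, so that T is too small for the quantiles to make sense, or T =
      0, where division by zero gives y = 0. Even pulling the arm in all T rounds then costs at most
      c^q / W.\<close>
    have "real T \<le> (c / \<Delta>) powr q"
    proof (cases "T = 0")
      case nz: False
      then have "0 < y" using c \<Delta> by (simp add: y_def)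
      with False have "1 \<le> y" by simp
      then show ?thesis using nz \<Delta> by (simp add: y_def powr_divide field_simps)
    qed simp
    then have "\<Delta> * real T \<le> \<Delta> * (c / \<Delta>) powr q" using \<Delta> by (intro mult_left_mono) auto
    also have "\<dots> = c powr q / W" using c by (intro div) simp
    also have "\<dots> \<le> Ccst C / W"
      using W C by (intro divide_right_mono) (auto simp: Ccst_def intro!: add_increasing2)
    also have "\<dots> \<le> bound_term c p F T (Ccst C) \<Delta>"
      unfolding bt using W \<Delta> by (auto intro!: add_increasing2)
    finally have le: "\<Delta> * real T \<le> bound_term c p F T (Ccst C) \<Delta>" .
    have "\<Delta> * real (npulls (hist R G T) a) \<le> bound_term c p F T (Ccst C) \<Delta>" for R G
      using npulls_le_length[of "hist R G T" a] \<Delta>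
      by (intro order_trans[OF _ le] mult_left_mono) auto
    then have "(\<integral>\<^sup>+\<omega>. ennreal (\<Delta> * real (npulls (hist (fst \<omega>) (snd \<omega>) T) a)) \<partial>\<Omega>)
        \<le> (\<integral>\<^sup>+\<omega>. ennreal (bound_term c p F T (Ccst C) \<Delta>) \<partial>\<Omega>)"
      by (intro nn_integral_mono ennreal_leI)
    then show ?thesis by (simp add: \<Omega>.emeasure_space_1)
  qed
qed

lemma bound_term_nonneg: "0 < C \<Longrightarrow> 0 < \<Delta> \<Longrightarrow> 0 \<le> bound_term c p F T (Ccst C) \<Delta>"
  unfolding bound_term_def Let_def
  by (intro add_nonneg_nonneg mult_nonneg_nonneg divide_nonneg_nonneg) (auto simp: Ccst_def intro!: add_nonneg_nonneg)

lemma expected_regret_le: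
  assumes C: "0 < C"
    and sum_le: "\<And>\<alpha> N. 0 < \<alpha> \<Longrightarrow> (\<Sum>n=1..N. exp (- (\<alpha> * real n powr (1 / q)))) \<le> C / \<alpha> powr q"
  shows "(\<integral>\<omega>. ape_regret K p c (mean_reward D) astar T (fst \<omega>) (snd \<omega>) \<partial>\<Omega>)
    \<le> (\<Sum>a\<in>{a. a < K \<and> a \<noteq> astar}. bound_term c p F T (Ccst C) (mean_reward D astar - mean_reward D a))"
\<comment> \<open>A bound on the nonnegative integral suffices, so all expectations above can stay
  in \<open>ennreal\<close>.\<close>
proof (rule integral_real_bounded)
  let ?S = "{a. a < K \<and> a \<noteq> astar}"
  let ?\<Delta> = "\<lambda>a. mean_reward D astar - mean_reward D a"
  have \<Delta>: "0 < ?\<Delta> a" if "a \<in> ?S" for a using opt[of a] that by simp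
  show "0 \<le> (\<Sum>a\<in>?S. bound_term c p F T (Ccst C) (?\<Delta> a))"
    using C \<Delta> by (intro sum_nonneg bound_term_nonneg)
  have "(\<integral>\<^sup>+\<omega>. ennreal (ape_regret K p c (mean_reward D) astar T (fst \<omega>) (snd \<omega>)) \<partial>\<Omega>)
      = (\<integral>\<^sup>+\<omega>. (\<Sum>a\<in>?S. ennreal (?\<Delta> a * real (npulls (hist (fst \<omega>) (snd \<omega>) T) a))) \<partial>\<Omega>)"
    unfolding ape_regret_eq using \<Delta> by (intro nn_integral_cong sum_ennreal[symmetric]) (simp add: less_imp_le)
  also have "\<dots> = (\<Sum>a\<in>?S. \<integral>\<^sup>+\<omega>. ennreal (?\<Delta> a * real (npulls (hist (fst \<omega>) (snd \<omega>) T) a)) \<partial>\<Omega>)"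
    by (rule nn_integral_sum) measurable
  also have "\<dots> \<le> (\<Sum>a\<in>?S. ennreal (bound_term c p F T (Ccst C) (?\<Delta> a)))"
    using C by (intro sum_mono nn_integral_arm_regret_le sum_le) auto
  also have "\<dots> = ennreal (\<Sum>a\<in>?S. bound_term c p F T (Ccst C) (?\<Delta> a))"
    using C \<Delta> by (intro sum_ennreal bound_term_nonneg)
  finally show "(\<integral>\<^sup>+\<omega>. ennreal (ape_regret K p c (mean_reward D) astar T (fst \<omega>) (snd \<omega>)) \<partial>\<Omega>)
      \<le> ennreal (\<Sum>a\<in>?S. bound_term c p F T (Ccst C) (?\<Delta> a))" .
qed

end

theorem theorem3:
  shows "\<exists>C0>0. \<forall>c p \<nu> F CF PG.
    (0 < c \<and> 1 < p \<and> p \<le> 2 \<and> perturbation_assm F CF \<and>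
     prob_space PG \<and> sets PG = sets borel \<and> (\<forall>g. measure PG {..<g} = F g))
    \<longrightarrow> (\<exists>Ccst>0. \<forall>K D astar T.
          ((\<forall>a. prob_space (D a) \<and> sets (D a) = sets borel) \<and>
           (\<forall>a<K. (\<integral>\<^sup>+ x. ennreal (\<bar>x\<bar> powr p) \<partial>(D a)) \<le> ennreal \<nu>) \<and>
           (\<forall>a<K. 0 \<le> mean_reward D a \<and> mean_reward D a \<le> 1) \<and>
           astar < K \<and> (\<forall>a<K. a \<noteq> astar \<longrightarrow> mean_reward D a < mean_reward D astar))
          \<longrightarrow> (\<integral>\<omega>. ape_regret K p c (mean_reward D) astar T (fst \<omega>) (snd \<omega>) \<partial>(bandit_space D PG))
              \<le> C0 * (\<Sum>a\<in>{a. a < K \<and> a \<noteq> astar}.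
                    bound_term c p F T Ccst (mean_reward D astar - mean_reward D a)))"
proof (rule exI[of _ 1], intro conjI allI impI)
  fix c p \<nu> :: real and F :: "real \<Rightarrow> real" and CF :: real and PG :: "real measure"
  assume asm: "0 < c \<and> 1 < p \<and> p \<le> 2 \<and> perturbation_assm F CF \<and>
     prob_space PG \<and> sets PG = sets borel \<and> (\<forall>g. measure PG {..<g} = F g)"
  define pq where "pq = p / (p - 1)"
  have "0 < pq" using asm by (simp add: pq_def)
  from sum_exp_neg_powr_le[OF this] obtain C where C: "0 < C"
    "\<And>\<alpha> N. 0 < \<alpha> \<Longrightarrow> (\<Sum>n=1..N. exp (- (\<alpha> * real n powr (1 / pq)))) \<le> C / \<alpha> powr pq"
    by blast
  \<comment> \<open>\<open>Ccst C\<close> written out in the parameters alone: the constant must be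
    fixed before K, D, \<open>astar\<close> and T, whereas the locale is interpreted only once these
    are given.\<close>
  define C' where "C' = 3 * c powr pq + (4 + max CF 0) * exp (bp p * max \<nu> 0 / c powr p) * (C * (6 * c) powr pq)"
  have "0 < C'"
    unfolding C'_def using asm C(1) by (intro add_pos_nonneg) auto
  moreover have "(\<integral>\<omega>. ape_regret K p c (mean_reward D) astar T (fst \<omega>) (snd \<omega>) \<partial>(bandit_space D PG))
      \<le> 1 * (\<Sum>a\<in>{a. a < K \<and> a \<noteq> astar}. bound_term c p F T C' (mean_reward D astar - mean_reward D a))"
    if D: "(\<forall>a. prob_space (D a) \<and> sets (D a) = sets borel) \<and>
           (\<forall>a<K. (\<integral>\<^sup>+ x. ennreal (\<bar>x\<bar> powr p) \<partial>(D a)) \<le> ennreal \<nu>) \<and>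
           (\<forall>a<K. 0 \<le> mean_reward D a \<and> mean_reward D a \<le> 1) \<and>
           astar < K \<and> (\<forall>a<K. a \<noteq> astar \<longrightarrow> mean_reward D a < mean_reward D astar)" for K D astar T
  proof -
    interpret bandit F CF PG p c \<nu> K D astar
      using asm D unfolding bandit_def bandit_axioms_def perturbation_def by blast
    have q: "q = pq" by (simp add: q_def pq_def)
    have "Ccst C = C'" by (simp add: Ccst_def C'_def Bc_def q)
    then show ?thesis using expected_regret_le[OF C[folded q], of T] by simp
  qed
  ultimately show "\<exists>Ccst>0. \<forall>K D astar T.
          ((\<forall>a. prob_space (D a) \<and> sets (D a) = sets borel) \<and>
           (\<forall>a<K. (\<integral>\<^sup>+ x. ennreal (\<bar>x\<bar> powr p) \<partial>(D a)) \<le> ennreal \<nu>) \<and>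
           (\<forall>a<K. 0 \<le> mean_reward D a \<and> mean_reward D a \<le> 1) \<and>
           astar < K \<and> (\<forall>a<K. a \<noteq> astar \<longrightarrow> mean_reward D a < mean_reward D astar))
          \<longrightarrow> (\<integral>\<omega>. ape_regret K p c (mean_reward D) astar T (fst \<omega>) (snd \<omega>) \<partial>(bandit_space D PG))
              \<le> 1 * (\<Sum>a\<in>{a. a < K \<and> a \<noteq> astar}.
                    bound_term c p F T Ccst (mean_reward D astar - mean_reward D a))"
    by blast
qed simp

end
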